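(* Let $K$ be a semi-equivelar map of type $(3,4^4)$ with $12$ vertices on a surface of Euler characteristic $-2$. If $K$ is non-orientable, then $K$ is isomorphic to one of $KNO_{1[(3,4^4)]}$ or $KNO_{2[(3,4^4)]}$. If $K$ is orientable, then $K$ is isomorphic to $KO_{[(3,4^4)]}$.
   Context: A surface is a compact connected 2-dimensional manifold without boundary. A map on a surface $S$ is a finite (combinatorial) polyhedral 2-complex $X$ whose geometric carrier is $S$: a finite vertex set $V(X)$, edges, and 2-faces that are polygons ($n$-gons, $n\ge 3$, each identified with a cycle of $n$ distinct vertices), such that any two distinct faces meet in the empty set, a single common vertex, or a single common edge. The faces containing a vertex $v$ are arranged cyclically around $v$. The vertex $v$ has face sequence $(a_1^{n_1},\dots,a_m^{n_m})$ if, going around $v$, one meets $n_1$ consecutive $a_1$-gons, then $n_2$ consecutive $a_2$-gons, ..., then $n_m$ consecutive $a_m$-gons (up to cyclic rotation and reversal). A map is semi-equivelar of type $(a_1^{n_1},\dots,a_m^{n_m})$ if all its vertices have this face sequence. A map is orientable (non-orientable) if its underlying surface is. Two maps are isomorphic if there is a bijection between their vertex sets carrying faces (as cycles) onto faces. The following maps have vertex set $\{0,1,\dots,11\}$; $[a,b,c]$ is a triangle and $[a,b,c,d]$ is the quadrilateral with boundary cycle $a\,b\,c\,d\,a$. $KNO_{1[(3,4^4)]}$ has faces: $[0,3,4]$, $[1,9,10]$, $[6,7,11]$, $[2,5,8]$, $[0,1,2,3]$, $[0,4,5,6]$, $[0,6,7,8]$, $[0,1,9,8]$, $[6,1,10,5]$,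 $[1,6,11,2]$, $[8,5,4,9]$, $[8,2,3,7]$, $[7,9,10,3]$, $[9,7,11,4]$, $[2,5,10,11]$, $[4,3,10,11]$. $KNO_{2[(3,4^4)]}$ has faces: $[0,3,4]$, $[6,7,11]$, $[1,9,10]$, $[2,5,8]$, $[0,1,2,3]$, $[0,4,5,6]$, $[0,6,7,8]$, $[0,1,9,8]$, $[1,6,11,2]$, $[6,1,10,5]$, $[3,4,10,11]$, $[11,10,5,2]$, $[3,2,8,9]$, $[3,9,7,11]$, $[4,5,8,7]$, $[4,7,9,10]$. $KO_{[(3,4^4)]}$ has faces: $[0,3,4]$, $[2,6,11]$, $[1,5,9]$, $[7,8,10]$, $[0,1,2,3]$, $[0,4,5,6]$, $[0,6,7,8]$, $[0,1,9,8]$, $[1,7,6,2]$, $[6,11,10,5]$, $[3,4,11,9]$, $[9,11,2,8]$, $[3,2,8,10]$, $[3,10,5,9]$, $[4,5,1,7]$, $[4,7,10,11]$. *)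

theory Defs
  imports Main
begin

definition arcs_of :: "'a list \<Rightarrow> ('a \<times> 'a) set" where
  "arcs_of xs = set (zip xs (rotate1 xs))"

text \<open>The undirected cycle \<open>x\<^sub>0 x\<^sub>1 \<dots> x\<^sub>n x\<^sub>0\<close>, represented by its set of edges. For \<open>n \<ge> 2\<close>
  and distinct \<open>x\<^sub>i\<close> this determines the cycle, and two lists give the same set iff they
  differ by rotation and reversal. The number of sides of a polygon \<open>C\<close> is thus \<open>card C\<close>, and
  its vertex set is \<open>\<Union>C\<close>.\<close>

definition cycle_of :: "'a list \<Rightarrow> 'a set set" where
  "cycle_of xs = (\<lambda>(u, v). {u, v}) ` arcs_of xs"

definition is_polygon :: "'a set set \<Rightarrow> bool" where
  "is_polygon C \<longleftrightarrow> (\<exists>xs. distinct xs \<and> 3 \<le> length xs \<and> C = cycle_of xs)"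

record 'a complex2 =
  verts :: "'a set"
  faces :: "'a set set set"

text \<open>On a surface every edge lies on a face, so the edges need not be recorded separately.\<close>

definition edges :: "'a complex2 \<Rightarrow> 'a set set" where
  "edges X = \<Union>(faces X)"

definition polyhedral :: "'a complex2 \<Rightarrow> bool" where
  "polyhedral X \<longleftrightarrow>
     finite (verts X) \<and>
     (\<forall>C \<in> faces X. is_polygon C \<and> \<Union>C \<subseteq> verts X) \<and>
     (\<forall>C \<in> faces X. \<forall>D \<in> faces X. C \<noteq> D \<longrightarrow>
        \<Union>C \<inter> \<Union>D = {} \<or> (\<exists>v. \<Union>C \<inter> \<Union>D = {v}) \<or> (\<exists>e \<in> C \<inter> D. \<Union>C \<inter> \<Union>D = e))"

text \<open>\<open>Cs\<close> lists all faces containing \<open>v\<close> in a cyclic order around \<open>v\<close>: there are distinct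
  edges \<open>e\<^sub>0, \<dots>, e\<^sub>m\<close> such that the two sides of the \<open>i\<close>-th face at \<open>v\<close> are \<open>e\<^sub>i\<close> and \<open>e\<^sub>i\<^sub>+\<^sub>1\<close>
  (cyclically). In other words, the star of \<open>v\<close> is a disc and the link of \<open>v\<close> is a circle.\<close>

definition cyclic_at :: "'a complex2 \<Rightarrow> 'a \<Rightarrow> 'a set set list \<Rightarrow> bool" where
  "cyclic_at X v Cs \<longleftrightarrow>
     Cs \<noteq> [] \<and> distinct Cs \<and> set Cs = {C \<in> faces X. v \<in> \<Union>C} \<and>
     (\<exists>es. distinct es \<and> length es = length Cs \<and>
        (\<forall>i < length Cs. {e \<in> Cs ! i. v \<in> e} = {es ! i, es ! (Suc i mod length Cs)}))"

definition connected_complex :: "'a complex2 \<Rightarrow> bool" where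
  "connected_complex X \<longleftrightarrow>
     verts X \<noteq> {} \<and> (\<forall>u \<in> verts X. \<forall>v \<in> verts X. (u, v) \<in> {(x, y). {x, y} \<in> edges X}\<^sup>*)"

text \<open>The carrier of a finite polyhedral 2-complex is a closed connected surface iff the complex is
  connected and the faces at each vertex form a single cycle.\<close>

definition surface_map :: "'a complex2 \<Rightarrow> bool" where
  "surface_map X \<longleftrightarrow>
     polyhedral X \<and> connected_complex X \<and> (\<forall>v \<in> verts X. \<exists>Cs. cyclic_at X v Cs)"

definition euler_char :: "'a complex2 \<Rightarrow> int" where
  "euler_char X = int (card (verts X)) - int (card (edges X)) + int (card (faces X))"

text \<open>A coherent orientation directs the boundary cycle of every face so that any two distinct faces
  traverse a common edge in opposite directions.\<close>

definition coherent_orientation :: "'a complex2 \<Rightarrow> ('a set set \<Rightarrow> ('a \<times> 'a) set) \<Rightarrow> bool" where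
  "coherent_orientation X dir \<longleftrightarrow>
     (\<forall>C \<in> faces X. \<exists>xs. distinct xs \<and> 3 \<le> length xs \<and> C = cycle_of xs \<and> dir C = arcs_of xs) \<and>
     (\<forall>C \<in> faces X. \<forall>D \<in> faces X. C \<noteq> D \<longrightarrow>
        (\<forall>u v. {u, v} \<in> C \<inter> D \<longrightarrow> ((u, v) \<in> dir C \<longleftrightarrow> (v, u) \<in> dir D)))"

definition orientable :: "'a complex2 \<Rightarrow> bool" where
  "orientable X \<longleftrightarrow> (\<exists>dir. coherent_orientation X dir)"

text \<open>A type \<open>(a\<^sub>1\<^bsup>n\<^sub>1\<^esup>, \<dots>, a\<^sub>m\<^bsup>n\<^sub>m\<^esup>)\<close> is given as the list of pairs \<open>(a\<^sub>i, n\<^sub>i)\<close>. Since a cyclic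
  arrangement may be rotated and reversed, the existential quantifier accounts for
  face sequences being taken up to rotation and reversal.\<close>

definition has_face_sequence :: "'a complex2 \<Rightarrow> 'a \<Rightarrow> (nat \<times> nat) list \<Rightarrow> bool" where
  "has_face_sequence X v ps \<longleftrightarrow>
     (\<exists>Cs. cyclic_at X v Cs \<and> map card Cs = concat (map (\<lambda>(a, n). replicate n a) ps))"

definition semi_equivelar :: "'a complex2 \<Rightarrow> (nat \<times> nat) list \<Rightarrow> bool" where
  "semi_equivelar X ps \<longleftrightarrow> surface_map X \<and> (\<forall>v \<in> verts X. has_face_sequence X v ps)"

definition isomorphic_maps :: "'a complex2 \<Rightarrow> 'b complex2 \<Rightarrow> bool" where
  "isomorphic_maps X Y \<longleftrightarrow>
     (\<exists>f. bij_betw f (verts X) (verts Y) \<and> (\<lambda>C. (\<lambda>e. f ` e) ` C) ` faces X = faces Y)"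

definition KNO1 :: "nat complex2" where
  "KNO1 = \<lparr> verts = {0..11}, faces = cycle_of `
     {[0,3,4], [1,9,10], [6,7,11], [2,5,8],
      [0,1,2,3], [0,4,5,6], [0,6,7,8], [0,1,9,8], [6,1,10,5], [1,6,11,2],
      [8,5,4,9], [8,2,3,7], [7,9,10,3], [9,7,11,4], [2,5,10,11], [4,3,10,11]} \<rparr>"

definition KNO2 :: "nat complex2" where
  "KNO2 = \<lparr> verts = {0..11}, faces = cycle_of `
     {[0,3,4], [6,7,11], [1,9,10], [2,5,8],
      [0,1,2,3], [0,4,5,6], [0,6,7,8], [0,1,9,8], [1,6,11,2], [6,1,10,5],
      [3,4,10,11], [11,10,5,2], [3,2,8,9], [3,9,7,11], [4,5,8,7], [4,7,9,10]} \<rparr>"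

definition KO :: "nat complex2" where
  "KO = \<lparr> verts = {0..11}, faces = cycle_of `
     {[0,3,4], [2,6,11], [1,5,9], [7,8,10],
      [0,1,2,3], [0,4,5,6], [0,6,7,8], [0,1,9,8], [1,7,6,2], [6,11,10,5],
      [3,4,11,9], [9,11,2,8], [3,2,8,10], [3,10,5,9], [4,5,1,7], [4,7,10,11]} \<rparr>"

end

theory Submission
  imports Defs
begin

text \<open>
  Five faces meet at a vertex \<open>v\<close>, a triangle and four quadrangles, and they form a disc bounded by
  a cycle of nine vertices: the five neighbours of \<open>v\<close> and the corners opposite to \<open>v\<close> of the four
  quadrangles. As two faces share at most an edge, these nine vertices are distinct
  (\<open>semi_equivelar_star\<close>). On twelve vertices exactly two vertices are therefore missing from the
  star of \<open>v\<close>, and all stars look alike. So one may call \<open>v\<close> vertex 0, name the boundary of its star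
  as in the three maps of the theorem, and give the names 10 and 11 to the two remaining vertices.
  Every map in question thus becomes a completion of five fixed labelled faces, and only finitely
  many sets of labelled polygons can be such a completion.

  The completions are found by a search, written as a functional program. It first chooses the
  triangles and then repeatedly takes an edge that lies on just one of the known faces. That edge
  lies on a second face, which must be a quadrangle because the triangle at each vertex is known
  already, and the search branches over the possible quadrangles. Two facts keep it small. A new face
  may meet the known ones only in a vertex or a common edge, which is decided by recording for each
  pair of vertices how the known faces contain it (\<open>status\<close>). And the known faces at a vertex use at
  most five edges there, and exactly five once they close up around the vertex, because the faces
  at a vertex form a single cycle (\<open>star_closure\<close>). The lemma \<open>all_maps_complete\<close> says that the
  search misses no map. Evaluated by rewriting, it yields 18 completions, and an explicit
  relabelling identifies each with one of the three maps (\<open>all_maps_match\<close>): 12 with \<open>KNO1\<close>, 2 with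
  \<open>KNO2\<close> and 4 with \<open>KO\<close>.

  Finally, orientability is invariant under isomorphism (\<open>orientable_isomorphic\<close>). The maps \<open>KNO1\<close>
  and \<open>KNO2\<close> contain a Moebius band made of three quadrangles, while the faces of \<open>KO\<close> can be
  directed so that no arc is used twice.
\<close>

section \<open>Cycles and polygons\<close>

lemma cycle_of_3: "cycle_of [a, b, c] = {{a, b}, {b, c}, {c, a}}"
  by (auto simp: cycle_of_def arcs_of_def)

lemma cycle_of_4: "cycle_of [a, b, c, d] = {{a, b}, {b, c}, {c, d}, {d, a}}"
  by (auto simp: cycle_of_def arcs_of_def)

lemma Union_cycle_of: "\<Union>(cycle_of xs) = set xs"
proof -
  have "set (map fst (zip xs (rotate1 xs))) = set xs" "set (map snd (zip xs (rotate1 xs))) = set xs"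
    by (simp_all add: map_fst_zip map_snd_zip)
  then have "fst ` arcs_of xs = set xs" "snd ` arcs_of xs = set xs"
    by (simp_all only: arcs_of_def set_map)
  moreover have "\<Union>(cycle_of xs) = fst ` arcs_of xs \<union> snd ` arcs_of xs"
    by (force simp: cycle_of_def)
  ultimately show ?thesis by simp
qed

lemma arcs_of_map: "arcs_of (map g xs) = map_prod g g ` arcs_of xs"
  by (simp add: arcs_of_def zip_map_map map_prod_def rotate1_map)

lemma image_cycle_of: "image (image g) (cycle_of xs) = cycle_of (map g xs)"
proof -
  show ?thesis
    by (auto simp: cycle_of_def arcs_of_map image_image split_beta)
qed

lemma arcs_of_nth: "arcs_of xs = {(xs ! i, xs ! (Suc i mod length xs)) | i. i < length xs}"
  by (auto simp: arcs_of_def set_zip nth_rotate1)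

lemma arcs_of_left_unique:
  assumes "distinct xs" "(a, v) \<in> arcs_of xs" "(b, v) \<in> arcs_of xs" shows "a = b"
proof -
  have "distinct (rotate1 xs)" using assms(1) by simp
  then show ?thesis using assms(2,3)
    unfolding arcs_of_def set_zip by (auto simp: nth_eq_iff_index_eq)
qed

lemma arcs_of_right_unique:
  assumes "distinct xs" "(v, a) \<in> arcs_of xs" "(v, b) \<in> arcs_of xs" shows "a = b"
  using assms unfolding arcs_of_def set_zip by (auto simp: nth_eq_iff_index_eq)

lemma arcs_of_subset: "arcs_of xs \<subseteq> set xs \<times> set xs"
proof
  fix e assume e: "e \<in> arcs_of xs"
  obtain u v where uv: "e = (u, v)" by fastforce
  have "u \<in> set xs" "v \<in> set (rotate1 xs)"
    using e unfolding uv arcs_of_def by (rule set_zip_leftD, rule set_zip_rightD)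
  then show "e \<in> set xs \<times> set xs" by (simp add: uv)
qed

lemma in_cycle_of: "{u, v} \<in> cycle_of xs \<longleftrightarrow> (u, v) \<in> arcs_of xs \<or> (v, u) \<in> arcs_of xs"
  by (auto simp: cycle_of_def doubleton_eq_iff)

text \<open>With at least three corners, different positions on the polygon give different sides. For a
  digon this would fail, both sides being the same set.\<close>

lemma card_cycle_of:
  assumes "distinct xs" "3 \<le> length xs" shows "card (cycle_of xs) = length xs"
proof -
  have "inj_on (\<lambda>i. {xs ! i, xs ! (Suc i mod length xs)}) {..<length xs}"
  proof (rule inj_onI)
    fix i j assume ij: "i \<in> {..<length xs}" "j \<in> {..<length xs}"
      and eq: "{xs ! i, xs ! (Suc i mod length xs)} = {xs ! j, xs ! (Suc j mod length xs)}"
    have lt: "Suc i mod length xs < length xs" "Suc j mod length xs < length xs"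
      using assms(2) by (auto intro!: mod_less_divisor)
    have "xs ! i = xs ! j \<or> (xs ! i = xs ! (Suc j mod length xs) \<and> xs ! (Suc i mod length xs) = xs ! j)"
      using eq by (auto simp: doubleton_eq_iff)
    then have "i = j \<or> (i = Suc j mod length xs \<and> Suc i mod length xs = j)"
      using assms(1) ij lt by (auto simp: nth_eq_iff_index_eq)
    then show "i = j"
      using assms(2) ij by (auto simp: mod_Suc split: if_splits)
  qed
  moreover have "cycle_of xs = (\<lambda>i. {xs ! i, xs ! (Suc i mod length xs)}) ` {..<length xs}"
    by (auto simp: cycle_of_def arcs_of_nth)
  ultimately show ?thesis by (simp add: card_image)
qed

lemma length_3E: assumes "length xs = 3" obtains a b c where "xs = [a, b, c]"
  using assms by (auto simp: numeral_eq_Suc length_Suc_conv)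
lemma length_4E: assumes "length xs = 4" obtains a b c d where "xs = [a, b, c, d]"
  using assms by (auto simp: numeral_eq_Suc length_Suc_conv)
lemma length_5E: assumes "length xs = 5" obtains a b c d e where "xs = [a, b, c, d, e]"
  using assms by (auto simp: numeral_eq_Suc length_Suc_conv)
lemma length_9E: assumes "length xs = 9" obtains a b c d e f g h i where "xs = [a, b, c, d, e, f, g, h, i]"
  using assms by (auto simp: numeral_eq_Suc length_Suc_conv)

text \<open>A polygon may be listed starting from any of its corners, so that facts about the faces at a
  vertex \<open>v\<close> need only be stated for lists with head \<open>v\<close>.\<close>

lemma triangle_at:
  assumes "is_polygon C" "card C = 3" "v \<in> \<Union>C"
  obtains a b where "distinct [v, a, b]" "C = cycle_of [v, a, b]"
proof -
  obtain xs where xs: "distinct xs" "3 \<le> length xs" "C = cycle_of xs"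
    using assms(1) by (auto simp: is_polygon_def)
  then have "length xs = 3" using assms(2) card_cycle_of by metis
  then obtain p q r where [simp]: "xs = [p, q, r]" by (rule length_3E)
  consider "v = p" | "v = q" | "v = r" using assms(3) xs(3) by (auto simp: Union_cycle_of)
  then show thesis
  proof cases
    case 1 then show ?thesis using xs that[of q r] by auto
  next
    case 2 then show ?thesis using xs that[of r p] by (auto simp: cycle_of_3)
  next
    case 3 then show ?thesis using xs that[of p q] by (auto simp: cycle_of_3)
  qed
qed

lemma quad_at:
  assumes "is_polygon C" "card C = 4" "v \<in> \<Union>C"
  obtains a x b where "distinct [v, a, x, b]" "C = cycle_of [v, a, x, b]"
proof -
  obtain xs where xs: "distinct xs" "3 \<le> length xs" "C = cycle_of xs"
    using assms(1) by (auto simp: is_polygon_def)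
  then have "length xs = 4" using assms(2) card_cycle_of by metis
  then obtain p q r s where [simp]: "xs = [p, q, r, s]" by (rule length_4E)
  consider "v = p" | "v = q" | "v = r" | "v = s" using assms(3) xs(3) by (auto simp: Union_cycle_of)
  then show thesis
  proof cases
    case 1 then show ?thesis using xs that[of q r s] by auto
  next
    case 2 then show ?thesis using xs that[of r s p] by (auto simp: cycle_of_4)
  next
    case 3 then show ?thesis using xs that[of s p q] by (auto simp: cycle_of_4)
  next
    case 4 then show ?thesis using xs that[of p q r] by (auto simp: cycle_of_4)
  qed
qed

lemma polygon_edge:
  assumes "is_polygon C" "e \<in> C" "v \<in> e"
  obtains w where "w \<noteq> v" "e = {v, w}"
proof -
  obtain xs where xs: "distinct xs" "3 \<le> length xs" and C: "C = cycle_of xs"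
    using assms(1) unfolding is_polygon_def by blast
  obtain a b where ab: "(a, b) \<in> arcs_of xs" "e = {a, b}"
    using assms(2) by (auto simp: C cycle_of_def)
  then obtain i where "i < length xs" "a = xs ! i" "b = xs ! (Suc i mod length xs)"
    by (auto simp: arcs_of_nth)
  moreover have "Suc i mod length xs \<noteq> i"
    using xs(2) \<open>i < length xs\<close> by (auto simp: mod_Suc split: if_splits)
  moreover have "Suc i mod length xs < length xs"
    using xs(2) by (intro mod_less_divisor) linarith
  ultimately have "a \<noteq> b" using xs(1) by (simp add: nth_eq_iff_index_eq)
  then show thesis using ab(2) assms(3) that[of a] that[of b] by (auto simp: insert_commute)
qed

lemma cycle_of_3_rev: "cycle_of [c, b, a] = cycle_of [a, b, c]"
  by (auto simp: cycle_of_3)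

lemma cycle_of_4_rev: "cycle_of [d, c, b, a] = cycle_of [a, b, c, d]"
  by (auto simp: cycle_of_4)

lemma cycle_of_3_flip: "cycle_of [v, b, a] = cycle_of [v, a, b]"
  by (auto simp: cycle_of_3)
lemma cycle_of_4_flip: "cycle_of [v, b, x, a] = cycle_of [v, a, x, b]"
  by (auto simp: cycle_of_4)

section \<open>The star of a vertex\<close>

text \<open>The rim is the boundary cycle of the star of \<open>v\<close>: the neighbours \<open>w\<^sub>0, \<dots>, w\<^sub>4\<close> of \<open>v\<close> in
  cyclic order, where \<open>v w\<^sub>0 w\<^sub>1\<close> is the triangle, and the corner \<open>x\<^sub>i\<close> opposite to \<open>v\<close> in the
  quadrangle between \<open>w\<^sub>i\<close> and its successor.\<close>

fun star_faces :: "'v \<Rightarrow> 'v list \<Rightarrow> 'v list list" where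
  "star_faces v [w0, w1, x1, w2, x2, w3, x3, w4, x4] =
     [[v, w0, w1], [v, w1, x1, w2], [v, w2, x2, w3], [v, w3, x3, w4], [v, w4, x4, w0]]"
| "star_faces v _ = []"

definition is_star :: "'v set set set \<Rightarrow> 'v \<Rightarrow> 'v list \<Rightarrow> bool" where
  "is_star \<Phi> v rim \<longleftrightarrow> length rim = 9 \<and> distinct (v # rim) \<and>
     {C \<in> \<Phi>. v \<in> \<Union>C} = cycle_of ` set (star_faces v rim)"

text \<open>Polyhedrality in the form in which it is used: a pair of vertices common to two faces is a side
  of both. In particular a diagonal of one face lies in no other face.\<close>

definition meet_properly :: "'v set set set \<Rightarrow> bool" where
  "meet_properly \<Phi> \<longleftrightarrow> (\<forall>C \<in> \<Phi>. \<forall>D \<in> \<Phi>. C \<noteq> D \<longrightarrow>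
     (\<forall>u v. u \<noteq> v \<and> {u, v} \<subseteq> \<Union>C \<inter> \<Union>D \<longrightarrow> {u, v} \<in> C \<inter> D))"

text \<open>All that the classification needs to know about a map of type \<open>(3, 4\<^sup>4)\<close>. Stated for a bare set of
  faces, it is easily carried over to labelled copies of the map.\<close>

locale star_system =
  fixes V :: "'v set" and \<Phi> :: "'v set set set"
  assumes face_vertex: "C \<in> \<Phi> \<Longrightarrow> \<Union>C \<subseteq> V \<and> \<Union>C \<noteq> {}"
    and meet: "meet_properly \<Phi>"
    and star: "v \<in> V \<Longrightarrow> \<exists>rim. is_star \<Phi> v rim"

lemma polyhedral_meet_properly:
  assumes "polyhedral X" shows "meet_properly (faces X)"
  unfolding meet_properly_def
proof (intro ballI impI allI)
  fix C D u v
  assume CD: "C \<in> faces X" "D \<in> faces X" "C \<noteq> D" and uv: "u \<noteq> v \<and> {u, v} \<subseteq> \<Union>C \<inter> \<Union>D"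
  have "\<Union>C \<inter> \<Union>D \<noteq> {w}" for w
  proof
    assume "\<Union>C \<inter> \<Union>D = {w}"
    then have "{u, v} \<subseteq> {w}" using uv by blast
    then show False using uv by simp
  qed
  moreover have "\<Union>C \<inter> \<Union>D \<noteq> {}" using uv by blast
  ultimately obtain e where e: "e \<in> C \<inter> D" "\<Union>C \<inter> \<Union>D = e"
    using assms CD unfolding polyhedral_def by (metis (no_types, lifting))
  have "is_polygon C" using assms CD(1) by (simp add: polyhedral_def)
  then obtain xs where "C = cycle_of xs" unfolding is_polygon_def by blast
  then obtain a b where "e = {a, b}" using e by (auto simp: cycle_of_def)
  then have "e = {u, v}" using uv e by auto
  then show "{u, v} \<in> C \<inter> D" using e by simp
qed

text \<open>The cyclic order of the faces determines five edges \<open>{v, w\<^sub>i}\<close> at \<open>v\<close>, and each face is listed so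
  that it runs from one of its two edges at \<open>v\<close> to the other. The corners opposite to \<open>v\<close> differ
  from each other and from the \<open>w\<^sub>i\<close> since the diagonal from \<open>v\<close> to such a corner lies in only one
  face.\<close>

lemma semi_equivelar_star:
  assumes X: "semi_equivelar X [(3, 1), (4, 4)]" and v: "v \<in> verts X"
  shows "\<exists>rim. is_star (faces X) v rim"
proof -
  have poly: "polyhedral X" using X by (simp add: semi_equivelar_def surface_map_def)
  note mp = polyhedral_meet_properly[OF poly, unfolded meet_properly_def, rule_format]
  have seq: "concat (map (\<lambda>(a, n). replicate n a) [(3, 1), (4, 4)]) = [3, 4, 4, 4, 4 :: nat]"
    by (simp add: numeral_eq_Suc)
  have "has_face_sequence X v [(3, 1), (4, 4)]" using X v by (simp add: semi_equivelar_def)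
  then obtain Cs where cyc: "cyclic_at X v Cs" and types: "map card Cs = [3, 4, 4, 4, 4]"
    unfolding has_face_sequence_def seq by (elim exE conjE)
  from cyc obtain es where es: "distinct es" "length es = length Cs"
    and sides: "\<forall>i < length Cs. {e \<in> Cs ! i. v \<in> e} = {es ! i, es ! (Suc i mod length Cs)}"
    unfolding cyclic_at_def by (elim conjE exE)
  have Cs: "distinct Cs" "set Cs = {C \<in> faces X. v \<in> \<Union>C}"
    using cyc unfolding cyclic_at_def by simp_all
  have len: "length Cs = 5" "length es = 5" using arg_cong[OF types, of length] es(2) by simp_all
  obtain C0 C1 C2 C3 C4 where Cs_eq: "Cs = [C0, C1, C2, C3, C4]" by (rule length_5E[OF len(1)])
  obtain e0 e1 e2 e3 e4 where es_eq: "es = [e0, e1, e2, e3, e4]" by (rule length_5E[OF len(2)])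
  have s: "{e \<in> C0. v \<in> e} = {e0, e1}" "{e \<in> C1. v \<in> e} = {e1, e2}" "{e \<in> C2. v \<in> e} = {e2, e3}"
    "{e \<in> C3. v \<in> e} = {e3, e4}" "{e \<in> C4. v \<in> e} = {e4, e0}"
    using sides[rule_format, of 0] sides[rule_format, of 1] sides[rule_format, of 2]
      sides[rule_format, of 3] sides[rule_format, of 4]
    by (simp_all add: Cs_eq es_eq)
  have c: "card C0 = 3" "card C1 = 4" "card C2 = 4" "card C3 = 4" "card C4 = 4"
    using types by (simp_all add: Cs_eq)
  have F: "C \<in> faces X" "v \<in> \<Union>C" "is_polygon C" if "C \<in> {C0, C1, C2, C3, C4}" for C
  proof -
    have "C \<in> set Cs" using that by (simp add: Cs_eq)
    then have "C \<in> {C \<in> faces X. v \<in> \<Union>C}" unfolding Cs(2) .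
    then show "C \<in> faces X" "v \<in> \<Union>C" by simp_all
    then show "is_polygon C" using poly by (simp add: polyhedral_def)
  qed
  have quad: "\<exists>x. distinct [v, a, x, b] \<and> C = cycle_of [v, a, x, b]"
    if C: "C \<in> {C1, C2, C3, C4}" "card C = 4" and ab: "{e \<in> C. v \<in> e} = {{v, a}, {v, b}}" for C a b
  proof -
    obtain a' x b' where ax: "distinct [v, a', x, b']" "C = cycle_of [v, a', x, b']"
      by (rule quad_at[OF F(3) C(2) F(2)]) (use C(1) in auto)
    have "{e \<in> C. v \<in> e} = {{v, a'}, {v, b'}}" using ax by (auto simp: cycle_of_4)
    then consider "a' = a" "b' = b" | "a' = b" "b' = a" using ab by (auto simp: doubleton_eq_iff)
    then show ?thesis
    proof cases
      case 1 then show ?thesis using ax by auto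
    next
      case 2
      then have "distinct [v, a, x, b]" "C = cycle_of [v, a, x, b]"
        using ax(1) unfolding ax(2) by (auto simp: cycle_of_4)
      then show ?thesis by blast
    qed
  qed
  have "e0 \<in> {e \<in> C0. v \<in> e}" "e1 \<in> {e \<in> C1. v \<in> e}" "e2 \<in> {e \<in> C2. v \<in> e}"
    "e3 \<in> {e \<in> C3. v \<in> e}" "e4 \<in> {e \<in> C4. v \<in> e}"
    unfolding s by simp_all
  then have e: "e0 \<in> C0" "v \<in> e0" "e1 \<in> C1" "v \<in> e1" "e2 \<in> C2" "v \<in> e2" "e3 \<in> C3" "v \<in> e3"
    "e4 \<in> C4" "v \<in> e4" by simp_all
  obtain w0 where w0: "w0 \<noteq> v" "e0 = {v, w0}" by (rule polygon_edge[OF F(3) e(1) e(2)]) simp_all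
  obtain w1 where w1: "w1 \<noteq> v" "e1 = {v, w1}" by (rule polygon_edge[OF F(3) e(3) e(4)]) simp_all
  obtain w2 where w2: "w2 \<noteq> v" "e2 = {v, w2}" by (rule polygon_edge[OF F(3) e(5) e(6)]) simp_all
  obtain w3 where w3: "w3 \<noteq> v" "e3 = {v, w3}" by (rule polygon_edge[OF F(3) e(7) e(8)]) simp_all
  obtain w4 where w4: "w4 \<noteq> v" "e4 = {v, w4}" by (rule polygon_edge[OF F(3) e(9) e(10)]) simp_all
  note w = w0(2) w1(2) w2(2) w3(2) w4(2)
  have wv: "v \<notin> {w0, w1, w2, w3, w4}" using w0 w1 w2 w3 w4 by auto
  have dw: "distinct [w0, w1, w2, w3, w4]"
    using es(1) by (auto simp: es_eq w)
  obtain x1 where x1: "distinct [v, w1, x1, w2]" "C1 = cycle_of [v, w1, x1, w2]"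
    using quad[of C1 w1 w2] s(2)[unfolded w] c(2) by blast
  obtain x2 where x2: "distinct [v, w2, x2, w3]" "C2 = cycle_of [v, w2, x2, w3]"
    using quad[of C2 w2 w3] s(3)[unfolded w] c(3) by blast
  obtain x3 where x3: "distinct [v, w3, x3, w4]" "C3 = cycle_of [v, w3, x3, w4]"
    using quad[of C3 w3 w4] s(4)[unfolded w] c(4) by blast
  obtain x4 where x4: "distinct [v, w4, x4, w0]" "C4 = cycle_of [v, w4, x4, w0]"
    using quad[of C4 w4 w0] s(5)[unfolded w] c(5) by blast
  note q = x1 x2 x3 x4
  obtain a b where ab: "distinct [v, a, b]" "C0 = cycle_of [v, a, b]"
    by (rule triangle_at[OF F(3) c(1) F(2)]) simp_all
  have "{e \<in> C0. v \<in> e} = {{v, a}, {v, b}}" using ab by (auto simp: cycle_of_3)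
  then consider "a = w0" "b = w1" | "a = w1" "b = w0" using s(1) w by (auto simp: doubleton_eq_iff)
  then have t: "C0 = cycle_of [v, w0, w1]"
    by cases (simp_all add: ab(2) cycle_of_3_flip)
  \<comment> \<open>a corner not adjacent to \<open>v\<close> on its face lies on no other face at \<open>v\<close>\<close>
  have far: "x \<notin> \<Union>D" if "C \<in> {C0, C1, C2, C3, C4}" "D \<in> {C0, C1, C2, C3, C4}" "C \<noteq> D"
    "x \<in> \<Union>C" "x \<noteq> v" "{v, x} \<notin> C" for C D x
  proof
    assume "x \<in> \<Union>D"
    then have "v \<noteq> x \<and> {v, x} \<subseteq> \<Union>C \<inter> \<Union>D" using F(2)[OF that(1)] F(2)[OF that(2)] that(4,5) by blast
    then have "{v, x} \<in> C \<inter> D" by (rule mp[OF F(1)[OF that(1)] F(1)[OF that(2)] that(3)])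
    then show False using that(6) by blast
  qed
  have dC: "distinct [C0, C1, C2, C3, C4]" using Cs(1) Cs_eq by simp
  have nx: "{v, x1} \<notin> C1" "{v, x2} \<notin> C2" "{v, x3} \<notin> C3" "{v, x4} \<notin> C4"
    using q by (auto simp: cycle_of_4 doubleton_eq_iff)
  have U: "\<Union>C0 = {v, w0, w1}" "\<Union>C1 = {v, w1, x1, w2}" "\<Union>C2 = {v, w2, x2, w3}"
    "\<Union>C3 = {v, w3, x3, w4}" "\<Union>C4 = {v, w4, x4, w0}"
    unfolding t q(2,4,6,8) Union_cycle_of by simp_all
  have "x1 \<notin> \<Union>C2" "x1 \<notin> \<Union>C3" "x1 \<notin> \<Union>C4"
    by (rule far[of C1]; use dC nx q(1) in \<open>auto simp: U\<close>)+
  moreover have "x2 \<notin> \<Union>C0" "x2 \<notin> \<Union>C3" "x2 \<notin> \<Union>C4"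
    by (rule far[of C2]; use dC nx q(3) in \<open>auto simp: U\<close>)+
  moreover have "x3 \<notin> \<Union>C0" "x3 \<notin> \<Union>C1" "x3 \<notin> \<Union>C4"
    by (rule far[of C3]; use dC nx q(5) in \<open>auto simp: U\<close>)+
  moreover have "x4 \<notin> \<Union>C1" "x4 \<notin> \<Union>C2"
    by (rule far[of C4]; use dC nx q(7) in \<open>auto simp: U\<close>)+
  ultimately have "distinct (v # [w0, w1, x1, w2, x2, w3, x3, w4, x4])"
    unfolding U using dw wv q(1,3,5,7) by auto
  moreover have "{C \<in> faces X. v \<in> \<Union>C} = cycle_of ` set (star_faces v [w0, w1, x1, w2, x2, w3, x3, w4, x4])"
    using Cs(2) by (simp add: Cs_eq t q(2,4,6,8))
  ultimately have "is_star (faces X) v [w0, w1, x1, w2, x2, w3, x3, w4, x4]"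
    unfolding is_star_def by (intro conjI) (simp only: list.size, simp, assumption+)
  then show ?thesis by (rule exI)
qed

lemma semi_equivelar_star_system:
  assumes X: "semi_equivelar X [(3, 1), (4, 4)]"
  shows "star_system (verts X) (faces X)"
proof (rule star_system.intro)
  have poly: "polyhedral X" using X by (simp add: semi_equivelar_def surface_map_def)
  show "\<Union>C \<subseteq> verts X \<and> \<Union>C \<noteq> {}" if "C \<in> faces X" for C
  proof -
    have "is_polygon C" and sub: "\<Union>C \<subseteq> verts X" using poly that by (simp_all add: polyhedral_def)
    then obtain xs where xs: "3 \<le> length xs" "C = cycle_of xs" unfolding is_polygon_def by blast
    then have "set xs \<noteq> {}" by auto
    then have "\<Union>C \<noteq> {}" by (simp only: xs(2) Union_cycle_of not_False_eq_True)
    then show ?thesis using sub by simp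
  qed
  show "meet_properly (faces X)" by (rule polyhedral_meet_properly[OF poly])
  show "\<exists>rim. is_star (faces X) v rim" if "v \<in> verts X" for v
    by (rule semi_equivelar_star[OF X that])
qed

section \<open>Partially known maps\<close>

text \<open>How a set of known faces contains a pair of vertices: in no face, as a side of one face, as a
  side of two faces, or in a face in which they are not adjacent. Equal vertices count as \<open>Apart\<close>,
  so that a vertex is never a candidate for a new neighbour of itself.\<close>

datatype status = Fresh | Half | Full | Apart

fun bump :: "status \<Rightarrow> status" where
  "bump Fresh = Half" | "bump Half = Full" | "bump Full = Full" | "bump Apart = Apart"

fun is_edge :: "status \<Rightarrow> bool" where
  "is_edge Fresh = False" | "is_edge Half = True" | "is_edge Full = True" | "is_edge Apart = False"

definition apart :: "'v set set set \<Rightarrow> 'v \<Rightarrow> 'v \<Rightarrow> bool" where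
  "apart \<S> u v \<longleftrightarrow> u = v \<or> (\<exists>C \<in> \<S>. u \<in> \<Union>C \<and> v \<in> \<Union>C \<and> {u, v} \<notin> C)"

definition status :: "'v set set set \<Rightarrow> 'v \<Rightarrow> 'v \<Rightarrow> status" where
  "status \<S> u v =
    (if apart \<S> u v then Apart
     else if {C \<in> \<S>. {u, v} \<in> C} = {} then Fresh
     else if card {C \<in> \<S>. {u, v} \<in> C} = 1 then Half else Full)"

lemma apart_insert:
  "apart (insert C \<S>) u v \<longleftrightarrow> apart \<S> u v \<or> u \<in> \<Union>C \<and> v \<in> \<Union>C \<and> {u, v} \<notin> C"
  unfolding apart_def by blast

lemma status_same: "status \<S> u u = Apart"
  by (simp add: status_def apart_def)

lemma status_near:
  assumes "\<not> apart \<S> u v"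
  shows "status \<S> u v = (if {C \<in> \<S>. {u, v} \<in> C} = {} then Fresh
    else if card {C \<in> \<S>. {u, v} \<in> C} = 1 then Half else Full)"
  using assms unfolding status_def by (simp only: if_False)

lemma status_empty: "status {} u v = (if u = v then Apart else Fresh)"
  by (simp add: status_def apart_def)

text \<open>If \<open>{u, v}\<close> is a side of one face, it is a side of every face that contains \<open>u\<close> and \<open>v\<close>.\<close>

lemma not_apart:
  assumes "meet_properly \<S>" "C \<in> \<S>" "{u, v} \<in> C" "u \<noteq> v"
  shows "\<not> apart \<S> u v"
proof -
  have "{u, v} \<in> D" if "D \<in> \<S>" "u \<in> \<Union>D" "v \<in> \<Union>D" for D
  proof (cases "D = C")
    case False
    have "u \<in> \<Union>C" "v \<in> \<Union>C" using assms(3) by auto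
    then have "{u, v} \<in> D \<inter> C"
      using assms(1)[unfolded meet_properly_def, rule_format, OF that(1) assms(2) False, of u v] that assms(4) by simp
    then show ?thesis by simp
  qed (use assms in simp)
  then show ?thesis using assms(4) unfolding apart_def by blast
qed

lemma meet_properly_subset: "meet_properly \<Phi> \<Longrightarrow> \<S> \<subseteq> \<Phi> \<Longrightarrow> meet_properly \<S>"
  unfolding meet_properly_def by (meson subsetD)

text \<open>This is why the statuses suffice for the bookkeeping: adding a face changes only the pairs of its
  own corners, each by a rule that does not refer to the other faces.\<close>

lemma status_insert:
  assumes "finite \<S>" "C \<notin> \<S>" and meet: "meet_properly (insert C \<S>)" and "u \<noteq> v"
  shows "status (insert C \<S>) u v =
    (if {u, v} \<in> C then bump (status \<S> u v)
     else if u \<in> \<Union>C \<and> v \<in> \<Union>C then Apart else status \<S> u v)"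
proof (cases "{u, v} \<in> C")
  case True
  let ?A = "{D \<in> \<S>. {u, v} \<in> D}"
  have near: "\<not> apart (insert C \<S>) u v" by (rule not_apart[OF meet _ True assms(4)]) simp
  then have near': "\<not> apart \<S> u v" by (simp add: apart_insert)
  have set: "{D \<in> insert C \<S>. {u, v} \<in> D} = insert C ?A" using True by blast
  have fin: "finite ?A" using assms(1) by simp
  then have "card (insert C ?A) = Suc (card ?A)" using assms(2) by simp
  then have "status (insert C \<S>) u v = (if ?A = {} then Half else Full)"
    unfolding status_near[OF near] set using fin by simp
  then show ?thesis using True by (simp only: status_near[OF near'] bump.simps if_True split: if_split) simp
next
  case False
  then have same: "{D \<in> insert C \<S>. {u, v} \<in> D} = {D \<in> \<S>. {u, v} \<in> D}" by blast
  show ?thesis using False unfolding status_def same apart_insert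
    by (cases "apart \<S> u v"; cases "u \<in> \<Union>C \<and> v \<in> \<Union>C")
      (simp_all only: if_True if_False simp_thms not_False_eq_True)
qed

lemma is_starE:
  assumes "is_star \<Phi> v rim"
  obtains w0 w1 x1 w2 x2 w3 x3 w4 x4 where "rim = [w0, w1, x1, w2, x2, w3, x3, w4, x4]"
    "distinct [v, w0, w1, x1, w2, x2, w3, x3, w4, x4]"
    "{C \<in> \<Phi>. v \<in> \<Union>C} = {cycle_of [v, w0, w1], cycle_of [v, w1, x1, w2], cycle_of [v, w2, x2, w3],
       cycle_of [v, w3, x3, w4], cycle_of [v, w4, x4, w0]}"
proof -
  obtain w0 w1 x1 w2 x2 w3 x3 w4 x4 where "rim = [w0, w1, x1, w2, x2, w3, x3, w4, x4]"
    using assms length_9E[of rim] unfolding is_star_def by metis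
  then show thesis using assms that[of w0 w1 x1 w2 x2 w3 x3 w4 x4] by (simp add: is_star_def)
qed

lemma star_faces_distinct:
  assumes "distinct [v, w0, w1, x1, w2, x2, w3, x3, w4, x4]"
  shows "distinct (map cycle_of (star_faces v [w0, w1, x1, w2, x2, w3, x3, w4, x4]))"
proof -
  have "distinct (map Union (map cycle_of (star_faces v [w0, w1, x1, w2, x2, w3, x3, w4, x4])))"
    using assms by (auto simp: Union_cycle_of comp_def simp del: Union_iff)
  then show ?thesis using distinct_map by blast
qed

text \<open>Each of the five edges at \<open>v\<close> lies on the two faces next to it in the cyclic order.\<close>

lemma star_edges:
  assumes star: "is_star \<Phi> v [w0, w1, x1, w2, x2, w3, x3, w4, x4]"
  shows "{C \<in> \<Phi>. {v, w0} \<in> C} = {cycle_of [v, w0, w1], cycle_of [v, w4, x4, w0]}"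
    and "{C \<in> \<Phi>. {v, w1} \<in> C} = {cycle_of [v, w0, w1], cycle_of [v, w1, x1, w2]}"
    and "{C \<in> \<Phi>. {v, w2} \<in> C} = {cycle_of [v, w1, x1, w2], cycle_of [v, w2, x2, w3]}"
    and "{C \<in> \<Phi>. {v, w3} \<in> C} = {cycle_of [v, w2, x2, w3], cycle_of [v, w3, x3, w4]}"
    and "{C \<in> \<Phi>. {v, w4} \<in> C} = {cycle_of [v, w3, x3, w4], cycle_of [v, w4, x4, w0]}"
    and "u \<notin> {w0, w1, w2, w3, w4} \<Longrightarrow> {C \<in> \<Phi>. {v, u} \<in> C} = {}"
proof -
  have d: "distinct [v, w0, w1, x1, w2, x2, w3, x3, w4, x4]"
    and at: "{C \<in> \<Phi>. v \<in> \<Union>C} = {cycle_of [v, w0, w1], cycle_of [v, w1, x1, w2], cycle_of [v, w2, x2, w3],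
       cycle_of [v, w3, x3, w4], cycle_of [v, w4, x4, w0]}"
    using star by (simp_all add: is_star_def)
  have *: "{C \<in> \<Phi>. {v, u} \<in> C} = {C \<in> {cycle_of [v, w0, w1], cycle_of [v, w1, x1, w2], cycle_of [v, w2, x2, w3],
       cycle_of [v, w3, x3, w4], cycle_of [v, w4, x4, w0]}. {v, u} \<in> C}" for u
    unfolding at[symmetric] by auto
  have sides: "{v, u} \<in> cycle_of [v, w0, w1] \<longleftrightarrow> u = w0 \<or> u = w1"
    "{v, u} \<in> cycle_of [v, w1, x1, w2] \<longleftrightarrow> u = w1 \<or> u = w2"
    "{v, u} \<in> cycle_of [v, w2, x2, w3] \<longleftrightarrow> u = w2 \<or> u = w3"
    "{v, u} \<in> cycle_of [v, w3, x3, w4] \<longleftrightarrow> u = w3 \<or> u = w4"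
    "{v, u} \<in> cycle_of [v, w4, x4, w0] \<longleftrightarrow> u = w4 \<or> u = w0" for u
    using d by (auto simp: cycle_of_3 cycle_of_4 doubleton_eq_iff)
  have pick: "{C \<in> {C0, C1, C2, C3, C4}. P C} = (if P C0 then {C0} else {}) \<union> (if P C1 then {C1} else {}) \<union>
     (if P C2 then {C2} else {}) \<union> (if P C3 then {C3} else {}) \<union> (if P C4 then {C4} else {})"
    for P and C0 C1 C2 C3 C4 :: "'a set set" by auto
  show "{C \<in> \<Phi>. {v, w0} \<in> C} = {cycle_of [v, w0, w1], cycle_of [v, w4, x4, w0]}"
    "{C \<in> \<Phi>. {v, w1} \<in> C} = {cycle_of [v, w0, w1], cycle_of [v, w1, x1, w2]}"
    "{C \<in> \<Phi>. {v, w2} \<in> C} = {cycle_of [v, w1, x1, w2], cycle_of [v, w2, x2, w3]}"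
    "{C \<in> \<Phi>. {v, w3} \<in> C} = {cycle_of [v, w2, x2, w3], cycle_of [v, w3, x3, w4]}"
    "{C \<in> \<Phi>. {v, w4} \<in> C} = {cycle_of [v, w3, x3, w4], cycle_of [v, w4, x4, w0]}"
    "u \<notin> {w0, w1, w2, w3, w4} \<Longrightarrow> {C \<in> \<Phi>. {v, u} \<in> C} = {}"
    unfolding * pick sides using d by auto
qed

context star_system
begin

text \<open>A face with a side \<open>{u, v}\<close> may be listed beginning with that side.\<close>

lemma edge_face_form:
  assumes C: "C \<in> \<Phi>" "{u, v} \<in> C"
  shows "(\<exists>x. distinct [u, v, x] \<and> C = cycle_of [u, v, x]) \<or>
    (\<exists>x w. distinct [u, v, x, w] \<and> C = cycle_of [u, v, x, w])"
proof -
  have "u \<in> \<Union>C" using C(2) by blast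
  then have "u \<in> V" using face_vertex[OF C(1)] by blast
  then obtain rim where star: "is_star \<Phi> u rim" using star by blast
  obtain w0 w1 x1 w2 x2 w3 x3 w4 x4 where
    d: "distinct [u, w0, w1, x1, w2, x2, w3, x3, w4, x4]"
    and at: "{C \<in> \<Phi>. u \<in> \<Union>C} = {cycle_of [u, w0, w1], cycle_of [u, w1, x1, w2], cycle_of [u, w2, x2, w3],
       cycle_of [u, w3, x3, w4], cycle_of [u, w4, x4, w0]}"
    by (rule is_starE[OF star])
  have quad: ?thesis if "distinct [u, a, x, b]" "C = cycle_of [u, a, x, b]" for a x b
  proof -
    have "v = a \<or> v = b" using C(2) that by (auto simp: cycle_of_4 doubleton_eq_iff)
    moreover have "cycle_of [u, b, x, a] = C" "distinct [u, b, x, a]"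
      using that by (simp_all add: cycle_of_4_flip) auto
    ultimately show ?thesis using that by metis
  qed
  have "C \<in> {C \<in> \<Phi>. u \<in> \<Union>C}" using C(1) \<open>u \<in> \<Union>C\<close> by simp
  then consider "C = cycle_of [u, w0, w1]" | "C = cycle_of [u, w1, x1, w2]" | "C = cycle_of [u, w2, x2, w3]"
    | "C = cycle_of [u, w3, x3, w4]" | "C = cycle_of [u, w4, x4, w0]"
    unfolding at by blast
  then show ?thesis
  proof cases
    case 1
    then have "v = w0 \<or> v = w1" using C(2) d by (auto simp: cycle_of_3 doubleton_eq_iff)
    moreover have "C = cycle_of [u, w1, w0]" using 1 by (simp add: cycle_of_3_flip)
    ultimately show ?thesis using 1 d by auto
  qed (rule quad; use d in auto; fail)+
qed

lemma edge_in_two_faces: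
  assumes C: "C \<in> \<Phi>" "{u, v} \<in> C"
  obtains D where "D \<noteq> C" "{B \<in> \<Phi>. {u, v} \<in> B} = {C, D}"
proof -
  note get = that
  have "u \<in> \<Union>C" using C(2) by blast
  then have "u \<in> V" using face_vertex[OF C(1)] by blast
  then obtain rim where star: "is_star \<Phi> u rim" using star by blast
  obtain w0 w1 x1 w2 x2 w3 x3 w4 x4 where rim: "rim = [w0, w1, x1, w2, x2, w3, x3, w4, x4]"
    and d: "distinct [u, w0, w1, x1, w2, x2, w3, x3, w4, x4]"
    by (rule is_starE[OF star])
  note edges = star_edges[OF star[unfolded rim]]
  have ne: "distinct [cycle_of [u, w0, w1], cycle_of [u, w1, x1, w2], cycle_of [u, w2, x2, w3],
      cycle_of [u, w3, x3, w4], cycle_of [u, w4, x4, w0]]"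
    using star_faces_distinct[OF d] by simp
  have pair: thesis if AB: "{B \<in> \<Phi>. {u, v} \<in> B} = {A, B}" "A \<noteq> B" for A B
  proof -
    have "C \<in> {A, B}" unfolding AB(1)[symmetric] using C by simp
    then have "\<exists>D. D \<noteq> C \<and> {B \<in> \<Phi>. {u, v} \<in> B} = {C, D}" unfolding AB(1) using AB(2) by blast
    then show thesis using get by blast
  qed
  have "v \<in> {w0, w1, w2, w3, w4}" using edges(6)[of v] C by blast
  then consider "v = w0" | "v = w1" | "v = w2" | "v = w3" | "v = w4" by blast
  then show thesis
  proof cases
    case 1 show ?thesis by (rule pair, unfold 1, rule edges(1)) (use ne in simp)
  next
    case 2 show ?thesis by (rule pair, unfold 2, rule edges(2)) (use ne in simp)
  next
    case 3 show ?thesis by (rule pair, unfold 3, rule edges(3)) (use ne in simp)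
  next
    case 4 show ?thesis by (rule pair, unfold 4, rule edges(4)) (use ne in simp)
  next
    case 5 show ?thesis by (rule pair, unfold 5, rule edges(5)) (use ne in simp)
  qed
qed

lemma triangle_unique:
  assumes "C \<in> \<Phi>" "D \<in> \<Phi>" "v \<in> \<Union>C" "v \<in> \<Union>D" "card C = 3" "card D = 3"
  shows "C = D"
proof -
  have "v \<in> V" using assms(1,3) face_vertex by blast
  then obtain rim where star: "is_star \<Phi> v rim" using star by blast
  obtain w0 w1 x1 w2 x2 w3 x3 w4 x4 where
    d: "distinct [v, w0, w1, x1, w2, x2, w3, x3, w4, x4]"
    and at: "{C \<in> \<Phi>. v \<in> \<Union>C} = {cycle_of [v, w0, w1], cycle_of [v, w1, x1, w2], cycle_of [v, w2, x2, w3],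
       cycle_of [v, w3, x3, w4], cycle_of [v, w4, x4, w0]}"
    by (rule is_starE[OF star])
  have "card (cycle_of [v, w1, x1, w2]) = 4" "card (cycle_of [v, w2, x2, w3]) = 4"
    "card (cycle_of [v, w3, x3, w4]) = 4" "card (cycle_of [v, w4, x4, w0]) = 4"
    by (subst card_cycle_of; use d in auto)+
  then have "B = cycle_of [v, w0, w1]" if "B \<in> {C \<in> \<Phi>. v \<in> \<Union>C}" "card B = 3" for B
    using that unfolding at by auto
  from this[of C] this[of D] show ?thesis using assms by blast
qed

lemma triangle_exists:
  assumes "v \<in> V"
  obtains a b where "distinct [v, a, b]" "cycle_of [v, a, b] \<in> \<Phi>"
proof -
  obtain rim where star: "is_star \<Phi> v rim" using star assms by blast
  obtain w0 w1 x1 w2 x2 w3 x3 w4 x4 where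
    d: "distinct [v, w0, w1, x1, w2, x2, w3, x3, w4, x4]"
    and at: "{C \<in> \<Phi>. v \<in> \<Union>C} = {cycle_of [v, w0, w1], cycle_of [v, w1, x1, w2], cycle_of [v, w2, x2, w3],
       cycle_of [v, w3, x3, w4], cycle_of [v, w4, x4, w0]}"
    by (rule is_starE[OF star])
  have "cycle_of [v, w0, w1] \<in> {C \<in> \<Phi>. v \<in> \<Union>C}" unfolding at by simp
  then show thesis using that[of w0 w1] d by simp
qed

lemma card_faces_at:
  assumes "v \<in> V" shows "card {C \<in> \<Phi>. v \<in> \<Union>C} = 5"
proof -
  obtain rim where star: "is_star \<Phi> v rim" using star assms by blast
  obtain w0 w1 x1 w2 x2 w3 x3 w4 x4 where
    d: "distinct [v, w0, w1, x1, w2, x2, w3, x3, w4, x4]"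
    and at: "{C \<in> \<Phi>. v \<in> \<Union>C} = {cycle_of [v, w0, w1], cycle_of [v, w1, x1, w2], cycle_of [v, w2, x2, w3],
       cycle_of [v, w3, x3, w4], cycle_of [v, w4, x4, w0]}"
    by (rule is_starE[OF star])
  show ?thesis unfolding at using star_faces_distinct[OF d] by simp
qed

text \<open>A face that is still unknown occupies one of the two places at each of its sides, so at most one
  known face can lie there.\<close>

lemma status_side:
  assumes "\<S> \<subseteq> \<Phi>" "C \<in> \<Phi> - \<S>" "{u, v} \<in> C" "u \<noteq> v"
  shows "status \<S> u v \<in> {Fresh, Half}"
proof -
  have C: "C \<in> \<Phi>" "C \<notin> \<S>" using assms(2) by simp_all
  have "\<not> apart \<Phi> u v" by (rule not_apart[OF meet C(1) assms(3,4)])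
  then have near: "\<not> apart \<S> u v" using assms(1) unfolding apart_def by blast
  obtain D where D: "D \<noteq> C" "{B \<in> \<Phi>. {u, v} \<in> B} = {C, D}"
    by (rule edge_in_two_faces[OF C(1) assms(3)])
  have "{B \<in> \<S>. {u, v} \<in> B} \<subseteq> {B \<in> \<Phi>. {u, v} \<in> B} - {C}" using assms(1) C(2) by auto
  then have "{B \<in> \<S>. {u, v} \<in> B} \<subseteq> {D}" unfolding D(2) by auto
  then have "{B \<in> \<S>. {u, v} \<in> B} = {} \<or> {B \<in> \<S>. {u, v} \<in> B} = {D}" by (rule subset_singletonD)
  then show ?thesis unfolding status_near[OF near] by (elim disjE) simp_all
qed

lemma status_diagonal:
  assumes "\<S> \<subseteq> \<Phi>" "C \<in> \<Phi> - \<S>" "{u, v} \<notin> C" "u \<in> \<Union>C" "v \<in> \<Union>C" "u \<noteq> v"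
  shows "status \<S> u v = Fresh"
proof -
  have none: "\<not> (u \<in> \<Union>B \<and> v \<in> \<Union>B)" if "B \<in> \<S>" for B
  proof
    assume "u \<in> \<Union>B \<and> v \<in> \<Union>B"
    then have "u \<noteq> v \<and> {u, v} \<subseteq> \<Union>B \<inter> \<Union>C" using assms(4-6) by blast
    moreover have "B \<in> \<Phi>" "C \<in> \<Phi>" "B \<noteq> C" using assms(1,2) that by auto
    ultimately show False using meet assms(3) unfolding meet_properly_def by blast
  qed
  then have "\<not> apart \<S> u v" using assms(6) unfolding apart_def by blast
  moreover have "{B \<in> \<S>. {u, v} \<in> B} = {}" using none by blast
  ultimately show ?thesis by (simp add: status_near)
qed

text \<open>The branching step of the search. The second face at the edge is not a triangle, because the
  only triangle at \<open>u\<close> is known.\<close>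

lemma other_quadrangle:
  assumes sub: "\<S> \<subseteq> \<Phi>" and half: "status \<S> u v = Half"
    and tri: "T \<in> \<S>" "u \<in> \<Union>T" "card T = 3"
  obtains x w where "distinct [u, v, x, w]" "cycle_of [u, v, x, w] \<in> \<Phi> - \<S>"
proof -
  have "card {B \<in> \<S>. {u, v} \<in> B} = 1" using half unfolding status_def by (auto split: if_splits)
  then obtain C where C: "{B \<in> \<S>. {u, v} \<in> B} = {C}" using card_1_singletonE by blast
  have "C \<in> {B \<in> \<S>. {u, v} \<in> B}" unfolding C by simp
  then have C': "C \<in> \<S>" "C \<in> \<Phi>" "{u, v} \<in> C" using sub by auto
  obtain D where D: "D \<noteq> C" "{B \<in> \<Phi>. {u, v} \<in> B} = {C, D}"
    by (rule edge_in_two_faces[OF C'(2,3)])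
  have "D \<in> {B \<in> \<Phi>. {u, v} \<in> B}" unfolding D(2) by simp
  then have D': "D \<in> \<Phi>" "{u, v} \<in> D" by auto
  have "D \<notin> {B \<in> \<S>. {u, v} \<in> B}" unfolding C using D(1) by simp
  then have D_new: "D \<notin> \<S>" using D'(2) by simp
  have "u \<in> \<Union>D" using D'(2) by blast
  have "D \<noteq> cycle_of [u, v, x]" if "distinct [u, v, x]" for x
  proof
    assume "D = cycle_of [u, v, x]"
    then have "card D = 3" using that by (simp add: card_cycle_of)
    then have "D = T" using triangle_unique[OF D'(1) _ \<open>u \<in> \<Union>D\<close> tri(2)] tri sub by blast
    then show False using tri D_new by blast
  qed
  then obtain x w where "distinct [u, v, x, w]" "D = cycle_of [u, v, x, w]"
    using edge_face_form[OF D'] by metis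
  then show thesis using that[of x w] D' D_new by simp
qed

text \<open>The pruning rule of the search. An edge \<open>{v, w}\<close> is \<open>Half\<close> iff exactly one of the two faces next to
  it in the cyclic order around \<open>v\<close> is known. If no edge is, then neighbouring faces are both known
  or both unknown, so either no face at \<open>v\<close> is known or all five are.\<close>

lemma star_closure:
  assumes v: "v \<in> V" and sub: "\<S> \<subseteq> \<Phi>"
  defines "E \<equiv> {u. is_edge (status \<S> v u)}"
  shows "finite E" "card E \<le> 5" "E = {} \<or> card E = 5 \<or> (\<exists>u. status \<S> v u = Half)"
proof -
  obtain rim where star: "is_star \<Phi> v rim" using star v by blast
  obtain w0 w1 x1 w2 x2 w3 x3 w4 x4 where rim: "rim = [w0, w1, x1, w2, x2, w3, x3, w4, x4]"
    and d: "distinct [v, w0, w1, x1, w2, x2, w3, x3, w4, x4]"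
    by (rule is_starE[OF star])
  note edges = star_edges[OF star[unfolded rim]]
  have ne: "distinct [cycle_of [v, w0, w1], cycle_of [v, w1, x1, w2], cycle_of [v, w2, x2, w3],
      cycle_of [v, w3, x3, w4], cycle_of [v, w4, x4, w0]]"
    using star_faces_distinct[OF d] by simp
  have *: "is_edge (status \<S> v u) \<longleftrightarrow> A \<in> \<S> \<or> B \<in> \<S>" "status \<S> v u = Half \<longleftrightarrow> (A \<in> \<S>) \<noteq> (B \<in> \<S>)"
    if AB: "{C \<in> \<Phi>. {v, u} \<in> C} = {A, B}" "A \<noteq> B" and "v \<noteq> u" for u A B
  proof -
    have "A \<in> {C \<in> \<Phi>. {v, u} \<in> C}" "B \<in> {C \<in> \<Phi>. {v, u} \<in> C}" unfolding AB(1) by simp_all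
    then have AB': "A \<in> \<Phi>" "B \<in> \<Phi>" "{v, u} \<in> A" "{v, u} \<in> B" by auto
    have "\<not> apart \<Phi> v u" by (rule not_apart[OF meet AB'(1,3) that(3)])
    then have near: "\<not> apart \<S> v u" using sub unfolding apart_def by blast
    have "{C \<in> \<S>. {v, u} \<in> C} = (if A \<in> \<S> then {A} else {}) \<union> (if B \<in> \<S> then {B} else {})"
    proof -
      have "{C \<in> \<S>. {v, u} \<in> C} = {C \<in> \<Phi>. {v, u} \<in> C} \<inter> \<S>" using sub by auto
      then show ?thesis unfolding AB(1) by auto
    qed
    then show "is_edge (status \<S> v u) \<longleftrightarrow> A \<in> \<S> \<or> B \<in> \<S>" "status \<S> v u = Half \<longleftrightarrow> (A \<in> \<S>) \<noteq> (B \<in> \<S>)"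
      unfolding status_near[OF near] using AB(2) by auto
  qed
  have sub5: "E \<subseteq> {w0, w1, w2, w3, w4}"
  proof
    fix u assume u: "u \<in> E"
    show "u \<in> {w0, w1, w2, w3, w4}"
    proof (rule ccontr)
      assume "u \<notin> {w0, w1, w2, w3, w4}"
      then have "{C \<in> \<Phi>. {v, u} \<in> C} = {}" by (rule edges(6))
      then have "{C \<in> \<S>. {v, u} \<in> C} = {}" using sub by auto
      then show False using u unfolding E_def status_def by (auto split: if_splits)
    qed
  qed
  have card5: "card {w0, w1, w2, w3, w4} = 5" using d by simp
  show "finite E" using sub5 by (rule finite_subset) simp
  show "card E \<le> 5" using card_mono[OF _ sub5] card5 by simp
  have vw: "v \<noteq> w0" "v \<noteq> w1" "v \<noteq> w2" "v \<noteq> w3" "v \<noteq> w4" using d by auto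
  show "E = {} \<or> card E = 5 \<or> (\<exists>u. status \<S> v u = Half)"
  proof (rule disjCI)
    assume no: "\<not> (card E = 5 \<or> (\<exists>u. status \<S> v u = Half))"
    note in_E = *(1)[OF edges(1) _ vw(1)] *(1)[OF edges(2) _ vw(2)] *(1)[OF edges(3) _ vw(3)]
      *(1)[OF edges(4) _ vw(4)] *(1)[OF edges(5) _ vw(5)]
    note Half = *(2)[OF edges(1) _ vw(1)] *(2)[OF edges(2) _ vw(2)] *(2)[OF edges(3) _ vw(3)]
      *(2)[OF edges(4) _ vw(4)] *(2)[OF edges(5) _ vw(5)]
    have agree: "cycle_of [v, w1, x1, w2] \<in> \<S> \<longleftrightarrow> cycle_of [v, w0, w1] \<in> \<S>"
      "cycle_of [v, w2, x2, w3] \<in> \<S> \<longleftrightarrow> cycle_of [v, w0, w1] \<in> \<S>"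
      "cycle_of [v, w3, x3, w4] \<in> \<S> \<longleftrightarrow> cycle_of [v, w0, w1] \<in> \<S>"
      "cycle_of [v, w4, x4, w0] \<in> \<S> \<longleftrightarrow> cycle_of [v, w0, w1] \<in> \<S>"
      using Half ne no by auto
    show "E = {}"
    proof (cases "cycle_of [v, w0, w1] \<in> \<S>")
      case True
      then have "{w0, w1, w2, w3, w4} \<subseteq> E"
        using in_E agree ne by (auto simp: E_def)
      then have "E = {w0, w1, w2, w3, w4}" using sub5 by blast
      then show ?thesis using card5 no by simp
    next
      case False
      then have "E \<inter> {w0, w1, w2, w3, w4} = {}"
        using in_E agree ne by (auto simp: E_def)
      then show ?thesis using sub5 by blast
    qed
  qed
qed

end

section \<open>A search for all completions of a labelled star\<close>

text \<open>The labels form a datatype, and vectors over labels have one constructor, because then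
  rewriting compares labels and reads vector entries in a single step each.\<close>

datatype label = L0 | L1 | L2 | L3 | L4 | L5 | L6 | L7 | L8 | L9 | L10 | L11

datatype 'a vec = Vec 'a 'a 'a 'a 'a 'a 'a 'a 'a 'a 'a 'a

fun get :: "label \<Rightarrow> 'a vec \<Rightarrow> 'a" where
  "get L0 (Vec a b c d e f g h i j k l) = a"
| "get L1 (Vec a b c d e f g h i j k l) = b"
| "get L2 (Vec a b c d e f g h i j k l) = c"
| "get L3 (Vec a b c d e f g h i j k l) = d"
| "get L4 (Vec a b c d e f g h i j k l) = e"
| "get L5 (Vec a b c d e f g h i j k l) = f"
| "get L6 (Vec a b c d e f g h i j k l) = g"
| "get L7 (Vec a b c d e f g h i j k l) = h"
| "get L8 (Vec a b c d e f g h i j k l) = i"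
| "get L9 (Vec a b c d e f g h i j k l) = j"
| "get L10 (Vec a b c d e f g h i j k l) = k"
| "get L11 (Vec a b c d e f g h i j k l) = l"

fun alter :: "label \<Rightarrow> ('a \<Rightarrow> 'a) \<Rightarrow> 'a vec \<Rightarrow> 'a vec" where
  "alter L0 m (Vec a b c d e f g h i j k l) = Vec (m a) b c d e f g h i j k l"
| "alter L1 m (Vec a b c d e f g h i j k l) = Vec a (m b) c d e f g h i j k l"
| "alter L2 m (Vec a b c d e f g h i j k l) = Vec a b (m c) d e f g h i j k l"
| "alter L3 m (Vec a b c d e f g h i j k l) = Vec a b c (m d) e f g h i j k l"
| "alter L4 m (Vec a b c d e f g h i j k l) = Vec a b c d (m e) f g h i j k l"
| "alter L5 m (Vec a b c d e f g h i j k l) = Vec a b c d e (m f) g h i j k l"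
| "alter L6 m (Vec a b c d e f g h i j k l) = Vec a b c d e f (m g) h i j k l"
| "alter L7 m (Vec a b c d e f g h i j k l) = Vec a b c d e f g (m h) i j k l"
| "alter L8 m (Vec a b c d e f g h i j k l) = Vec a b c d e f g h (m i) j k l"
| "alter L9 m (Vec a b c d e f g h i j k l) = Vec a b c d e f g h i (m j) k l"
| "alter L10 m (Vec a b c d e f g h i j k l) = Vec a b c d e f g h i j (m k) l"
| "alter L11 m (Vec a b c d e f g h i j k l) = Vec a b c d e f g h i j k (m l)"

lemma get_alter: "get x (alter y m r) = (if x = y then m (get x r) else get x r)"
  by (cases r; cases x; cases y) simp_all

definition labels :: "label list" where
  "labels = [L0, L1, L2, L3, L4, L5, L6, L7, L8, L9, L10, L11]"

lemma set_labels: "set labels = UNIV"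
proof -
  have "x \<in> set labels" for x by (cases x) (simp_all add: labels_def)
  then show ?thesis by blast
qed

lemma distinct_labels: "distinct labels"
  by (simp add: labels_def)

type_synonym table = "status vec vec"
type_synonym state = "label list list \<times> table"

definition entry :: "table \<Rightarrow> label \<Rightarrow> label \<Rightarrow> status" where
  "entry t u v = get v (get u t)"

definition empty_table :: table where
  "empty_table = Vec
    (Vec Apart Fresh Fresh Fresh Fresh Fresh Fresh Fresh Fresh Fresh Fresh Fresh)
    (Vec Fresh Apart Fresh Fresh Fresh Fresh Fresh Fresh Fresh Fresh Fresh Fresh)
    (Vec Fresh Fresh Apart Fresh Fresh Fresh Fresh Fresh Fresh Fresh Fresh Fresh)
    (Vec Fresh Fresh Fresh Apart Fresh Fresh Fresh Fresh Fresh Fresh Fresh Fresh)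
    (Vec Fresh Fresh Fresh Fresh Apart Fresh Fresh Fresh Fresh Fresh Fresh Fresh)
    (Vec Fresh Fresh Fresh Fresh Fresh Apart Fresh Fresh Fresh Fresh Fresh Fresh)
    (Vec Fresh Fresh Fresh Fresh Fresh Fresh Apart Fresh Fresh Fresh Fresh Fresh)
    (Vec Fresh Fresh Fresh Fresh Fresh Fresh Fresh Apart Fresh Fresh Fresh Fresh)
    (Vec Fresh Fresh Fresh Fresh Fresh Fresh Fresh Fresh Apart Fresh Fresh Fresh)
    (Vec Fresh Fresh Fresh Fresh Fresh Fresh Fresh Fresh Fresh Apart Fresh Fresh)
    (Vec Fresh Fresh Fresh Fresh Fresh Fresh Fresh Fresh Fresh Fresh Apart Fresh)
    (Vec Fresh Fresh Fresh Fresh Fresh Fresh Fresh Fresh Fresh Fresh Fresh Apart)"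

lemma entry_empty: "entry empty_table u v = (if u = v then Apart else Fresh)"
  unfolding entry_def empty_table_def by (cases u; cases v) simp_all

text \<open>The effect of a new triangle and of a new quadrangle on the row of its corner \<open>b\<close>: here \<open>a\<close> and \<open>c\<close>
  are the neighbours of \<open>b\<close> on the face and, in a quadrangle, \<open>d\<close> is the corner opposite to \<open>b\<close>.\<close>

definition wedge :: "label \<Rightarrow> label \<Rightarrow> label \<Rightarrow> table \<Rightarrow> table" where
  "wedge a b c t = alter b (\<lambda>r. alter a bump (alter c bump r)) t"

definition corner :: "label \<Rightarrow> label \<Rightarrow> label \<Rightarrow> label \<Rightarrow> table \<Rightarrow> table" where
  "corner a b c d t = alter b (\<lambda>r. alter a bump (alter c bump (alter d (\<lambda>_. Apart) r))) t"

fun add_face :: "label list \<Rightarrow> table \<Rightarrow> table" where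
  "add_face [a, b, c] t = wedge a b c (wedge b c a (wedge c a b t))"
| "add_face [a, b, c, d] t = corner d a b c (corner a b c d (corner b c d a (corner c d a b t)))"
| "add_face _ t = t"

lemma entry_wedge:
  assumes "distinct [a, b, c]"
  shows "entry (wedge a b c t) u v = (if u = b \<and> (v = a \<or> v = c) then bump (entry t u v) else entry t u v)"
  using assms by (auto simp: entry_def wedge_def get_alter)

lemma entry_corner:
  assumes "distinct [a, b, c, d]"
  shows "entry (corner a b c d t) u v = (if u = b \<and> (v = a \<or> v = c) then bump (entry t u v)
    else if u = b \<and> v = d then Apart else entry t u v)"
  using assms by (auto simp: entry_def corner_def get_alter)

text \<open>The same rule as in \<open>status_insert\<close>.\<close>

lemma entry_add_face:
  assumes "distinct F" "length F = 3 \<or> length F = 4" "u \<noteq> v"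
  shows "entry (add_face F t) u v = (if {u, v} \<in> cycle_of F then bump (entry t u v)
    else if u \<in> set F \<and> v \<in> set F then Apart else entry t u v)"
  using assms(2)
proof
  assume "length F = 3"
  then obtain a b c where F: "F = [a, b, c]" by (rule length_3E)
  have d: "distinct [a, b, c]" "distinct [b, c, a]" "distinct [c, a, b]" using assms(1) F by auto
  show ?thesis
    using assms(3) d(1) unfolding F add_face.simps entry_wedge[OF d(1)] entry_wedge[OF d(2)] entry_wedge[OF d(3)] cycle_of_3
    by (auto simp: doubleton_eq_iff)
next
  assume "length F = 4"
  then obtain a b c d where F: "F = [a, b, c, d]" by (rule length_4E)
  have di: "distinct [a, b, c, d]" "distinct [b, c, d, a]" "distinct [c, d, a, b]" "distinct [d, a, b, c]"
    using assms(1) F by auto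
  show ?thesis
    using assms(3) di(1)
    unfolding F add_face.simps entry_corner[OF di(1)] entry_corner[OF di(2)] entry_corner[OF di(3)]
      entry_corner[OF di(4)] cycle_of_4
    by (auto simp: doubleton_eq_iff)
qed

lemma entry_add_face_same:
  assumes "distinct F" "length F = 3 \<or> length F = 4" "entry t u u = Apart"
  shows "entry (add_face F t) u u = Apart"
  using assms(2)
proof
  assume "length F = 3"
  then obtain a b c where F: "F = [a, b, c]" by (rule length_3E)
  have d: "distinct [a, b, c]" "distinct [b, c, a]" "distinct [c, a, b]" using assms(1) F by auto
  show ?thesis
    unfolding F add_face.simps entry_wedge[OF d(1)] entry_wedge[OF d(2)] entry_wedge[OF d(3)] assms(3) by simp
next
  assume "length F = 4"
  then obtain a b c d where F: "F = [a, b, c, d]" by (rule length_4E)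
  have di: "distinct [a, b, c, d]" "distinct [b, c, d, a]" "distinct [c, d, a, b]" "distinct [d, a, b, c]"
    using assms(1) F by auto
  show ?thesis
    unfolding F add_face.simps entry_corner[OF di(1)] entry_corner[OF di(2)] entry_corner[OF di(3)]
      entry_corner[OF di(4)] assms(3) by simp
qed

text \<open>The pair may be a side of one more face.\<close>

fun free :: "status \<Rightarrow> bool" where
  "free Fresh = True" | "free Half = True" | "free Full = False" | "free Apart = False"

fun entries :: "'a vec \<Rightarrow> 'a list" where
  "entries (Vec a b c d e f g h i j k l) = [a, b, c, d, e, f, g, h, i, j, k, l]"

lemma entries_eq: "entries r = map (\<lambda>x. get x r) labels"
  by (cases r) (simp add: labels_def)

text \<open>The condition of \<open>star_closure\<close> on the list of the edges at a vertex.\<close>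

fun star_ok :: "status list \<Rightarrow> bool" where
  "star_ok [] = True"
| "star_ok [a] = (a = Half)"
| "star_ok [a, b] = (a = Half \<or> b = Half)"
| "star_ok [a, b, c] = (a = Half \<or> b = Half \<or> c = Half)"
| "star_ok [a, b, c, d] = (a = Half \<or> b = Half \<or> c = Half \<or> d = Half)"
| "star_ok [a, b, c, d, e] = True"
| "star_ok (a # b # c # d # e # f # xs) = False"

definition row_ok :: "status vec \<Rightarrow> bool" where
  "row_ok r = star_ok (filter is_edge (entries r))"

lemma star_okI:
  assumes "length xs \<le> 5" "xs = [] \<or> length xs = 5 \<or> Half \<in> set xs"
  shows "star_ok xs"
  using assms by (induction xs rule: star_ok.induct) auto

fun add :: "label list \<Rightarrow> state \<Rightarrow> state" where
  "add F (S, t) = (F # S, add_face F t)"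

fun legal :: "state \<Rightarrow> bool" where
  "legal (F # S, t) = list_all (\<lambda>v. row_ok (get v t)) F"
| "legal ([], t) = True"

definition extend :: "label list list \<Rightarrow> state \<Rightarrow> state list" where
  "extend Fs s = filter legal (map (\<lambda>F. add F s) Fs)"

text \<open>The two-element subsets of a list, each listed in one order only, so that no triangle is tried
  twice.\<close>

fun pairs :: "'a list \<Rightarrow> ('a \<times> 'a) list" where
  "pairs [] = []" | "pairs (x # xs) = map (Pair x) xs @ pairs xs"

lemma in_pairs: "a \<in> set xs \<Longrightarrow> b \<in> set xs \<Longrightarrow> a \<noteq> b \<Longrightarrow> (a, b) \<in> set (pairs xs) \<or> (b, a) \<in> set (pairs xs)"
  by (induction xs) auto

fun is_triangle :: "'a list \<Rightarrow> bool" where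
  "is_triangle [a, b, c] = True" | "is_triangle _ = False"

lemma is_triangle_iff: "is_triangle F \<longleftrightarrow> length F = 3"
  by (cases F rule: is_triangle.cases) auto

definition in_triangles :: "'a list list \<Rightarrow> 'a list" where
  "in_triangles S = concat (filter is_triangle S)"

definition triangles_at :: "label \<Rightarrow> label list \<Rightarrow> table \<Rightarrow> label list list" where
  "triangles_at u T t = map (\<lambda>(a, b). [u, a, b])
     (filter (\<lambda>(a, b). free (entry t a b)) (pairs (filter (\<lambda>a. a \<notin> set T \<and> free (entry t u a)) labels)))"

fun grow_triangle :: "label \<Rightarrow> state \<Rightarrow> state list" where
  "grow_triangle u (S, t) = (if u \<in> set (in_triangles S) then [(S, t)]
     else extend (triangles_at u (in_triangles S) t) (S, t))"

text \<open>The possible corners \<open>x\<close> of a quadrangle that are opposite to \<open>u\<close> and adjacent to \<open>v\<close>, given the rows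
  of \<open>u\<close> and \<open>v\<close>.\<close>

definition candidates :: "status vec \<Rightarrow> status vec \<Rightarrow> label list" where
  "candidates r s = filter (\<lambda>x. get x r = Fresh \<and> free (get x s)) labels"

text \<open>The quadrangles \<open>u v x w\<close> all of whose sides and diagonals have an admissible status.\<close>

definition quadrangles_on :: "label \<Rightarrow> label \<Rightarrow> table \<Rightarrow> label list list" where
  "quadrangles_on u v t = concat (map (\<lambda>x. map (\<lambda>w. [u, v, x, w])
      (filter (\<lambda>w. free (entry t x w)) (candidates (get v t) (get u t))))
     (candidates (get u t) (get v t)))"

text \<open>The state is returned unchanged when no open edge is left at \<open>u\<close>: the star of \<open>u\<close> is complete.\<close>

fun grow :: "label \<Rightarrow> state \<Rightarrow> state list" where
  "grow u (S, t) = (case find (\<lambda>v. entry t u v = Half) labels of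
     None \<Rightarrow> [(S, t)] | Some v \<Rightarrow> extend (quadrangles_on u v t) (S, t))"

fun run :: "(label \<Rightarrow> state \<Rightarrow> state list) \<Rightarrow> label list \<Rightarrow> state \<Rightarrow> state list" where
  "run g [] s = [s]"
| "run g (u # us) s = concat (map (run g us) (g u s))"

text \<open>The five faces at vertex 0 that the three maps of the theorem have in common.\<close>

definition start :: state where
  "start = foldr add (star_faces L0 [L3, L4, L5, L6, L7, L8, L9, L1, L2]) ([], empty_table)"

text \<open>Four steps complete the star of a vertex whose triangle is known. The order of the vertices was
  chosen to make the search tree small: the star of 0 is complete already, and the vertices that
  follow it have much of their stars filled by the faces at 0.\<close>

definition agenda :: "label list" where
  "agenda = concat (map (replicate 4) [L0, L6, L1, L8, L3, L4, L2, L5, L7, L9, L10, L11])"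

definition all_maps :: "state list" where
  "all_maps = concat (map (run grow agenda) (run grow_triangle labels start))"

section \<open>The search misses nothing\<close>

text \<open>The state is a part of the map \<open>\<Phi>\<close>, without repetitions, and its table is correct.\<close>

definition consistent :: "label set set set \<Rightarrow> state \<Rightarrow> bool" where
  "consistent \<Phi> s \<longleftrightarrow>
     (\<forall>F \<in> set (fst s). distinct F \<and> (length F = 3 \<or> length F = 4) \<and> cycle_of F \<in> \<Phi>) \<and>
     distinct (map cycle_of (fst s)) \<and>
     (\<forall>u v. entry (snd s) u v = status (cycle_of ` set (fst s)) u v)"

lemma consistent_empty: "consistent \<Phi> ([], empty_table)"
  by (simp add: consistent_def entry_empty status_empty)

locale labelled_star_system = star_system "UNIV :: label set" \<Phi> for \<Phi>
begin

lemma consistent_add: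
  assumes s: "consistent \<Phi> s" and F: "distinct F" "length F = 3 \<or> length F = 4" "cycle_of F \<in> \<Phi>"
    and new: "cycle_of F \<notin> cycle_of ` set (fst s)"
  shows "consistent \<Phi> (add F s)"
proof -
  obtain S t where st: "s = (S, t)" by fastforce
  have S: "\<forall>F \<in> set S. distinct F \<and> (length F = 3 \<or> length F = 4) \<and> cycle_of F \<in> \<Phi>"
    "distinct (map cycle_of S)" and t: "\<And>u v. entry t u v = status (cycle_of ` set S) u v"
    using s by (simp_all add: st consistent_def)
  have mp: "meet_properly (insert (cycle_of F) (cycle_of ` set S))"
    by (rule meet_properly_subset[OF meet]) (use S(1) F(3) in auto)
  have "entry (add_face F t) u v = status (insert (cycle_of F) (cycle_of ` set S)) u v" for u v
  proof (cases "u = v")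
    case True
    have "entry (add_face F t) u u = Apart"
      by (rule entry_add_face_same[OF F(1,2)]) (simp add: t status_same)
    then show ?thesis using True by (simp add: status_same)
  next
    case False
    have "cycle_of F \<notin> cycle_of ` set S" using new st by simp
    from status_insert[OF _ this mp False]
    show ?thesis unfolding entry_add_face[OF F(1,2) False] t Union_cycle_of by simp
  qed
  then show ?thesis using S F new by (simp add: st consistent_def)
qed

lemma known_faces_subset: "consistent \<Phi> s \<Longrightarrow> cycle_of ` set (fst s) \<subseteq> \<Phi>"
  unfolding consistent_def by blast

lemma row_ok_consistent:
  assumes "consistent \<Phi> s" shows "row_ok (get v (snd s))"
proof -
  let ?\<S> = "cycle_of ` set (fst s)" and ?E = "{u. is_edge (status (cycle_of ` set (fst s)) v u)}"
  have t: "get u (get v (snd s)) = status ?\<S> v u" for u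
    using assms by (simp add: consistent_def flip: entry_def)
  let ?us = "filter (\<lambda>u. is_edge (status ?\<S> v u)) labels"
  have row: "filter is_edge (entries (get v (snd s))) = map (status ?\<S> v) ?us"
    unfolding entries_eq filter_map comp_def t by simp
  have us: "set ?us = ?E" "length ?us = card ?E"
    using distinct_card[of ?us] distinct_labels by (simp_all add: set_labels)
  note closure = star_closure[OF UNIV_I known_faces_subset[OF assms], of v]
  show ?thesis unfolding row_ok_def row
  proof (rule star_okI)
    show "length (map (status ?\<S> v) ?us) \<le> 5" using closure(2) us(2) by simp
    have "Half \<in> set (map (status ?\<S> v) ?us)" if "status ?\<S> v u = Half" for u
      unfolding set_map us(1) using that by (intro image_eqI[of _ _ u]) simp_all
    moreover have "?us = []" if "?E = {}" using us(1) that by (metis set_empty)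
    ultimately show "map (status ?\<S> v) ?us = [] \<or> length (map (status ?\<S> v) ?us) = 5 \<or>
        Half \<in> set (map (status ?\<S> v) ?us)"
      using closure(3) us(2) by (metis length_map list.map_disc_iff)
  qed
qed

text \<open>If some face of the map is among the proposed ones and is not yet known, then the branch that adds
  it survives the legality test.\<close>

lemma extend_sound:
  assumes s: "consistent \<Phi> s" and F: "F \<in> set Fs" "distinct F" "length F = 3 \<or> length F = 4" "cycle_of F \<in> \<Phi>"
    and new: "cycle_of F \<notin> cycle_of ` set (fst s)"
  shows "\<exists>s' \<in> set (extend Fs s). consistent \<Phi> s' \<and> F \<in> set (fst s')"
proof
  obtain S t where st: "s = (S, t)" by fastforce
  have c: "consistent \<Phi> (add F s)" by (rule consistent_add[OF s F(2-4) new])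
  then show "consistent \<Phi> (add F s) \<and> F \<in> set (fst (add F s))" by (simp add: st)
  have "legal (add F s)" using row_ok_consistent[OF c] by (simp add: st list_all_iff)
  then show "add F s \<in> set (extend Fs s)" using F(1) by (simp add: extend_def)
qed

lemma extend_mono: "s' \<in> set (extend Fs s) \<Longrightarrow> set (fst s) \<subseteq> set (fst s')"
  by (cases s) (auto simp: extend_def)

lemma grow_mono: "s' \<in> set (grow u s) \<Longrightarrow> set (fst s) \<subseteq> set (fst s')"
  by (cases s) (auto split: option.splits dest!: extend_mono)

lemma grow_triangle_mono: "s' \<in> set (grow_triangle u s) \<Longrightarrow> set (fst s) \<subseteq> set (fst s')"
  by (cases s) (auto split: if_splits dest!: extend_mono)

lemma run_mono:
  assumes g: "\<And>u s s'. s' \<in> set (g u s) \<Longrightarrow> set (fst s) \<subseteq> set (fst s')"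
  shows "s' \<in> set (run g us s) \<Longrightarrow> set (fst s) \<subseteq> set (fst s')"
proof (induction us arbitrary: s)
  case (Cons u us)
  then obtain s1 where "s1 \<in> set (g u s)" "s' \<in> set (run g us s1)" by auto
  then show ?case using g Cons.IH by blast
qed simp

text \<open>The triangle \<open>u a b\<close> of the map shares no vertex with the known triangles, as a vertex lies on one
  triangle only.\<close>

lemma grow_triangle_sound:
  assumes s: "consistent \<Phi> s"
  shows "\<exists>s' \<in> set (grow_triangle u s). consistent \<Phi> s' \<and> (\<exists>F \<in> set (fst s'). length F = 3 \<and> u \<in> set F)"
proof -
  obtain S t where st: "s = (S, t)" by fastforce
  have S: "F \<in> set S \<Longrightarrow> distinct F" "F \<in> set S \<Longrightarrow> cycle_of F \<in> \<Phi>" for F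
    using s by (simp_all add: st consistent_def)
  have in_tri: "a \<in> set (in_triangles S) \<longleftrightarrow> (\<exists>F \<in> set S. length F = 3 \<and> a \<in> set F)" for a
    by (auto simp: in_triangles_def is_triangle_iff)
  show ?thesis
  proof (cases "u \<in> set (in_triangles S)")
    case True
    then show ?thesis using s in_tri by (simp add: st)
  next
    case False
    obtain a b where ab: "distinct [u, a, b]" "cycle_of [u, a, b] \<in> \<Phi>"
      by (rule triangle_exists[of u]) auto
    have c3: "card (cycle_of [u, a, b]) = 3" using ab(1) by (simp add: card_cycle_of)
    have far: "\<not> (length F = 3 \<and> x \<in> set F)" if "F \<in> set S" "x \<in> {u, a, b}" for F x
    proof
      assume F: "length F = 3 \<and> x \<in> set F"
      then have "card (cycle_of F) = 3" using S(1)[OF that(1)] by (simp add: card_cycle_of)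
      moreover have "x \<in> \<Union>(cycle_of F)" "x \<in> \<Union>(cycle_of [u, a, b])"
        unfolding Union_cycle_of using F that(2) by auto
      ultimately have "cycle_of F = cycle_of [u, a, b]"
        using triangle_unique[OF S(2)[OF that(1)] ab(2)] c3 by blast
      then have "\<Union>(cycle_of F) = \<Union>(cycle_of [u, a, b])" by simp
      then have "u \<in> set F" unfolding Union_cycle_of by simp
      then show False using False F that(1) in_tri by blast
    qed
    then have new: "cycle_of [u, a, b] \<notin> cycle_of ` set (fst s)"
    proof -
      have "cycle_of F \<noteq> cycle_of [u, a, b]" if "F \<in> set S" for F
      proof
        assume eq: "cycle_of F = cycle_of [u, a, b]"
        have "u \<in> set F" using arg_cong[OF eq, of Union] unfolding Union_cycle_of by simp
        moreover have "length F = 3 \<or> length F = 4" using s that by (simp add: st consistent_def)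
        then have "length F = 3" using c3 S(1)[OF that] card_cycle_of[of F] unfolding eq[symmetric] by auto
        ultimately show False using far[OF that, of u] by simp
      qed
      then show ?thesis by (auto simp: st)
    qed
    have side: "free (entry t x y)" if "{x, y} \<in> cycle_of [u, a, b]" "x \<noteq> y" for x y
    proof -
      have "status (cycle_of ` set S) x y \<in> {Fresh, Half}"
        using status_side[OF known_faces_subset[OF s] _ that] ab(2) new by (simp add: st)
      moreover have "entry t x y = status (cycle_of ` set S) x y" using s by (simp add: st consistent_def)
      ultimately show ?thesis by auto
    qed
    have free: "free (entry t u a)" "free (entry t u b)" "free (entry t a b)" "free (entry t b a)"
      using ab(1) by (auto intro!: side simp: cycle_of_3)
    let ?cs = "filter (\<lambda>a. a \<notin> set (in_triangles S) \<and> free (entry t u a)) labels"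
    have "a \<in> set ?cs" "b \<in> set ?cs"
      using far free by (auto simp: set_labels in_tri)
    then have "(a, b) \<in> set (pairs ?cs) \<or> (b, a) \<in> set (pairs ?cs)"
      using in_pairs[of a ?cs b] ab(1) by simp
    then have "[u, a, b] \<in> set (triangles_at u (in_triangles S) t) \<or> [u, b, a] \<in> set (triangles_at u (in_triangles S) t)"
      unfolding triangles_at_def using free by force
    then obtain F where F: "F \<in> set (triangles_at u (in_triangles S) t)" "F = [u, a, b] \<or> F = [u, b, a]" by blast
    then have "distinct F" "length F = 3" "cycle_of F = cycle_of [u, a, b]" "u \<in> set F"
      using ab(1) by (auto simp: cycle_of_3_flip)
    then show ?thesis
      using extend_sound[OF s F(1)] ab(2) new False by (auto simp: st)
  qed
qed

lemma grow_sound: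
  assumes s: "consistent \<Phi> s" and tri: "\<exists>F \<in> set (fst s). length F = 3 \<and> u \<in> set F"
  shows "\<exists>s' \<in> set (grow u s). consistent \<Phi> s'"
proof -
  obtain S t where st: "s = (S, t)" by fastforce
  have t: "entry t x y = status (cycle_of ` set S) x y" for x y
    using s by (simp add: st consistent_def)
  show ?thesis
  proof (cases "find (\<lambda>v. entry t u v = Half) labels")
    case None
    then show ?thesis using s by (simp add: st)
  next
    case (Some v)
    then have half: "status (cycle_of ` set S) u v = Half" by (auto simp: find_Some_iff t)
    obtain T where T: "T \<in> set S" "length T = 3" "u \<in> set T" using tri st by auto
    have "u \<in> \<Union>(cycle_of T)" "card (cycle_of T) = 3"
      unfolding Union_cycle_of using T s by (simp_all add: st consistent_def card_cycle_of)
    then obtain x w where xw: "distinct [u, v, x, w]" "cycle_of [u, v, x, w] \<in> \<Phi> - cycle_of ` set S"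
      using other_quadrangle[OF _ half, of "cycle_of T"] known_faces_subset[OF s] T(1) st by auto
    have sub: "cycle_of ` set S \<subseteq> \<Phi>" using known_faces_subset[OF s] st by simp
    have side: "free (entry t y z)" if "{y, z} \<in> cycle_of [u, v, x, w]" "y \<noteq> z" for y z
      using status_side[OF sub xw(2) that] unfolding t by auto
    have diagonal: "entry t y z = Fresh" if "{y, z} \<notin> cycle_of [u, v, x, w]" "y \<noteq> z"
      "y \<in> {u, v, x, w}" "z \<in> {u, v, x, w}" for y z
      unfolding t by (rule status_diagonal[OF sub xw(2) that(1)]) (use that in \<open>simp_all add: Union_cycle_of del: Union_iff\<close>)
    have "entry t u x = Fresh" "entry t v w = Fresh"
      using xw(1) by (auto intro!: diagonal simp: cycle_of_4 doubleton_eq_iff)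
    moreover have "free (entry t v x)" "free (entry t u w)" "free (entry t x w)"
      using xw(1) by (auto intro!: side simp: cycle_of_4)
    ultimately have "[u, v, x, w] \<in> set (quadrangles_on u v t)"
      by (auto simp: quadrangles_on_def candidates_def set_labels simp flip: entry_def)
    then show ?thesis
      using extend_sound[OF s, of "[u, v, x, w]" "quadrangles_on u v t"] xw Some by (auto simp: st)
  qed
qed

lemma run_grow_triangle_sound:
  assumes "consistent \<Phi> s"
  shows "\<exists>s' \<in> set (run grow_triangle us s). consistent \<Phi> s' \<and>
    (\<forall>u \<in> set us. \<exists>F \<in> set (fst s'). length F = 3 \<and> u \<in> set F)"
  using assms
proof (induction us arbitrary: s)
  case (Cons u us)
  obtain s1 where s1: "s1 \<in> set (grow_triangle u s)" "consistent \<Phi> s1" "\<exists>F \<in> set (fst s1). length F = 3 \<and> u \<in> set F"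
    using grow_triangle_sound[OF Cons.prems] by blast
  obtain s' where s': "s' \<in> set (run grow_triangle us s1)" "consistent \<Phi> s'"
    "\<forall>u \<in> set us. \<exists>F \<in> set (fst s'). length F = 3 \<and> u \<in> set F"
    using Cons.IH[OF s1(2)] by blast
  have "\<exists>F \<in> set (fst s'). length F = 3 \<and> u \<in> set F"
    using run_mono[of grow_triangle s' us s1] grow_triangle_mono s'(1) s1(3) by blast
  then show ?case using s1(1) s' by auto
qed simp

lemma run_grow_sound:
  assumes "consistent \<Phi> s" "\<forall>u. \<exists>F \<in> set (fst s). length F = 3 \<and> u \<in> set F"
  shows "\<exists>s' \<in> set (run grow us s). consistent \<Phi> s'"
  using assms
proof (induction us arbitrary: s)
  case (Cons u us)
  obtain s1 where s1: "s1 \<in> set (grow u s)" "consistent \<Phi> s1"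
    using grow_sound[OF Cons.prems(1)] Cons.prems(2) by blast
  have "\<forall>u. \<exists>F \<in> set (fst s1). length F = 3 \<and> u \<in> set F"
    using grow_mono[OF s1(1)] Cons.prems(2) by blast
  then obtain s' where "s' \<in> set (run grow us s1)" "consistent \<Phi> s'"
    using Cons.IH[OF s1(2)] by blast
  then show ?case using s1(1) by auto
qed simp

lemma consistent_foldr_add:
  assumes "\<And>F. F \<in> set Fs \<Longrightarrow> distinct F \<and> (length F = 3 \<or> length F = 4) \<and> cycle_of F \<in> \<Phi>"
    and "distinct (map cycle_of Fs)"
  shows "consistent \<Phi> (foldr add Fs ([], empty_table)) \<and> fst (foldr add Fs ([], empty_table)) = Fs"
  using assms
proof (induction Fs)
  case Nil
  then show ?case by (simp add: consistent_empty)
next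
  case (Cons F Fs)
  let ?s = "foldr add Fs ([], empty_table)"
  have IH: "consistent \<Phi> ?s" "fst ?s = Fs" using Cons by simp_all
  have "consistent \<Phi> (add F ?s)"
    by (rule consistent_add[OF IH(1)]) (use Cons.prems IH(2) in auto)
  moreover have "fst (add F ?s) = F # Fs" using IH(2) by (cases ?s) simp
  ultimately show ?case by simp
qed

text \<open>Whatever the map is, one branch of the search follows it through to the end.\<close>

lemma all_maps_complete:
  assumes star: "is_star \<Phi> L0 [L3, L4, L5, L6, L7, L8, L9, L1, L2]"
  shows "\<exists>s \<in> set all_maps. consistent \<Phi> s"
proof -
  let ?Fs = "star_faces L0 [L3, L4, L5, L6, L7, L8, L9, L1, L2]"
  have "consistent \<Phi> start" unfolding start_def
  proof (rule conjunct1[OF consistent_foldr_add])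
    show "distinct (map cycle_of ?Fs)" by (rule star_faces_distinct) simp
    fix F assume F: "F \<in> set ?Fs"
    have "{C \<in> \<Phi>. L0 \<in> \<Union>C} = cycle_of ` set ?Fs" using star unfolding is_star_def by (elim conjE)
    then have "cycle_of F \<in> {C \<in> \<Phi>. L0 \<in> \<Union>C}" using imageI[OF F, of cycle_of] by (simp only:)
    then show "distinct F \<and> (length F = 3 \<or> length F = 4) \<and> cycle_of F \<in> \<Phi>"
      using F by auto
  qed
  then obtain s where s: "s \<in> set (run grow_triangle labels start)" "consistent \<Phi> s"
    "\<forall>u. \<exists>F \<in> set (fst s). length F = 3 \<and> u \<in> set F"
    using run_grow_triangle_sound[of start labels] by (auto simp: set_labels)
  then show ?thesis using run_grow_sound[OF s(2,3), of agenda] by (auto simp: all_maps_def)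
qed

end

section \<open>Evaluating the search\<close>

definition KNO1_faces :: "label list list" where
  "KNO1_faces =
     [[L0,L3,L4], [L1,L9,L10], [L6,L7,L11], [L2,L5,L8],
      [L0,L1,L2,L3], [L0,L4,L5,L6], [L0,L6,L7,L8], [L0,L1,L9,L8], [L6,L1,L10,L5], [L1,L6,L11,L2],
      [L8,L5,L4,L9], [L8,L2,L3,L7], [L7,L9,L10,L3], [L9,L7,L11,L4], [L2,L5,L10,L11], [L4,L3,L10,L11]]"

definition KNO2_faces :: "label list list" where
  "KNO2_faces =
     [[L0,L3,L4], [L6,L7,L11], [L1,L9,L10], [L2,L5,L8],
      [L0,L1,L2,L3], [L0,L4,L5,L6], [L0,L6,L7,L8], [L0,L1,L9,L8], [L1,L6,L11,L2], [L6,L1,L10,L5],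
      [L3,L4,L10,L11], [L11,L10,L5,L2], [L3,L2,L8,L9], [L3,L9,L7,L11], [L4,L5,L8,L7], [L4,L7,L9,L10]]"

definition KO_faces :: "label list list" where
  "KO_faces =
     [[L0,L3,L4], [L2,L6,L11], [L1,L5,L9], [L7,L8,L10],
      [L0,L1,L2,L3], [L0,L4,L5,L6], [L0,L6,L7,L8], [L0,L1,L9,L8], [L1,L7,L6,L2], [L6,L11,L10,L5],
      [L3,L4,L11,L9], [L9,L11,L2,L8], [L3,L2,L8,L10], [L3,L10,L5,L9], [L4,L5,L1,L7], [L4,L7,L10,L11]]"

text \<open>Whether two lists of length 3 or 4 describe the same cycle, decided by going through the rotations
  and reflections of the first.\<close>

fun same_cycle :: "'a list \<Rightarrow> 'a list \<Rightarrow> bool" where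
  "same_cycle [a, b, c] ys \<longleftrightarrow>
     ys \<in> set [[a, b, c], [b, c, a], [c, a, b], [c, b, a], [b, a, c], [a, c, b]]"
| "same_cycle [a, b, c, d] ys \<longleftrightarrow>
     ys \<in> set [[a, b, c, d], [b, c, d, a], [c, d, a, b], [d, a, b, c],
               [d, c, b, a], [c, b, a, d], [b, a, d, c], [a, d, c, b]]"
| "same_cycle _ ys \<longleftrightarrow> False"

text \<open>The faces in \<open>S\<close>, renamed by the permutation \<open>\<pi>\<close>, are exactly the faces \<open>Fs\<close>. That every vertex
  lies on five faces of \<open>S\<close> ensures that \<open>S\<close> is a whole map and not only a part of one.\<close>

fun matches :: "label list list \<Rightarrow> label list list \<times> label vec \<Rightarrow> bool" where
  "matches S (Fs, \<pi>) \<longleftrightarrow> distinct (entries \<pi>) \<and>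
     list_all (\<lambda>v. length (filter (\<lambda>F. v \<in> set F) S) = 5) labels \<and>
     list_all (\<lambda>F. list_ex (same_cycle (map (\<lambda>x. get x \<pi>) F)) Fs) S \<and>
     list_all (\<lambda>G. list_ex (\<lambda>F. same_cycle (map (\<lambda>x. get x \<pi>) F) G) S) Fs"

text \<open>For each completion, in the order in which the search finds them, the map to which it is
  isomorphic and an isomorphism, given by the images of the labels \<open>L0, \<dots>, L11\<close>.\<close>

definition relabellings :: "(label list list \<times> label vec) list" where
  "relabellings =
  [(KO_faces, Vec L0 L1 L2 L3 L4 L5 L6 L7 L8 L9 L11 L10),
   (KO_faces, Vec L0 L1 L2 L3 L4 L5 L6 L7 L8 L9 L10 L11),
   (KNO1_faces, Vec L2 L11 L10 L5 L8 L7 L3 L0 L1 L6 L9 L4),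
   (KNO1_faces, Vec L2 L11 L10 L5 L8 L7 L3 L0 L1 L6 L4 L9),
   (KO_faces, Vec L0 L6 L5 L4 L3 L2 L1 L9 L8 L7 L11 L10),
   (KO_faces, Vec L0 L6 L5 L4 L3 L2 L1 L9 L8 L7 L10 L11),
   (KNO1_faces, Vec L0 L1 L2 L3 L4 L5 L6 L7 L8 L9 L10 L11),
   (KNO2_faces, Vec L0 L1 L2 L3 L4 L5 L6 L7 L8 L9 L10 L11),
   (KNO1_faces, Vec L1 L6 L5 L10 L9 L8 L0 L3 L2 L11 L7 L4),
   (KNO1_faces, Vec L1 L0 L8 L9 L10 L5 L6 L11 L2 L3 L4 L7),
   (KNO1_faces, Vec L10 L3 L7 L9 L1 L6 L5 L2 L11 L4 L0 L8),
   (KNO1_faces, Vec L2 L3 L7 L8 L5 L10 L11 L6 L1 L0 L4 L9),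
   (KNO1_faces, Vec L0 L1 L2 L3 L4 L5 L6 L7 L8 L9 L11 L10),
   (KNO2_faces, Vec L0 L1 L2 L3 L4 L5 L6 L7 L8 L9 L11 L10),
   (KNO1_faces, Vec L1 L6 L5 L10 L9 L8 L0 L3 L2 L11 L4 L7),
   (KNO1_faces, Vec L1 L0 L8 L9 L10 L5 L6 L11 L2 L3 L7 L4),
   (KNO1_faces, Vec L10 L3 L7 L9 L1 L6 L5 L2 L11 L4 L8 L0),
   (KNO1_faces, Vec L2 L3 L7 L8 L5 L10 L11 L6 L1 L0 L9 L4)]"

text \<open>The search is evaluated by rewriting (\<open>all_maps_match\<close>), where a conditional makes the simplifier
  visit the chosen branch once more, together with all data in it. The following code equations
  avoid this by passing evaluated arguments to an auxiliary function.\<close>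

fun push :: "bool \<Rightarrow> 'a \<Rightarrow> 'a list \<Rightarrow> 'a list" where
  "push True x xs = x # xs" | "push False x xs = xs"

fun first :: "bool \<Rightarrow> 'a \<Rightarrow> 'a option \<Rightarrow> 'a option" where
  "first True x y = Some x" | "first False x y = y"

lemma [code]: "filter P [] = []" "filter P (x # xs) = push (P x) x (filter P xs)"
  by simp_all

lemma [code]: "find P [] = None" "find P (x # xs) = first (P x) x (find P xs)"
  by simp_all

lemma all_maps_match: "list_all2 matches (map fst all_maps) relabellings"
  by code_simp

lemma all_maps_matched:
  assumes "s \<in> set all_maps"
  obtains Fs \<pi> where "(Fs, \<pi>) \<in> set relabellings" "matches (fst s) (Fs, \<pi>)"
proof -
  have "fst s \<in> set (map fst all_maps)" using assms by simp
  then obtain i where i: "i < length (map fst all_maps)" "map fst all_maps ! i = fst s"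
    by (meson in_set_conv_nth)
  have "matches (fst s) (relabellings ! i)" using list_all2_nthD[OF all_maps_match i(1)] unfolding i(2) .
  moreover have "relabellings ! i \<in> set relabellings"
    using i(1) list_all2_lengthD[OF all_maps_match] by (intro nth_mem) linarith
  moreover obtain Fs \<pi> where "relabellings ! i = (Fs, \<pi>)" by (rule prod.exhaust)
  ultimately show thesis using that[of Fs \<pi>] by (simp only:)
qed

lemma cycle_of_eq_if_same_cycle:
  assumes "same_cycle xs ys" shows "cycle_of xs = cycle_of ys"
proof -
  have "cycle_of [b, c, a] = cycle_of [a, b, c]" "cycle_of [c, a, b] = cycle_of [a, b, c]"
    "cycle_of [c, b, a] = cycle_of [a, b, c]" "cycle_of [b, a, c] = cycle_of [a, b, c]"
    "cycle_of [a, c, b] = cycle_of [a, b, c]" for a b c :: 'a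
    by (simp_all only: cycle_of_3 insert_commute)
  moreover have "cycle_of [b, c, d, a] = cycle_of [a, b, c, d]" "cycle_of [c, d, a, b] = cycle_of [a, b, c, d]"
    "cycle_of [d, a, b, c] = cycle_of [a, b, c, d]" "cycle_of [d, c, b, a] = cycle_of [a, b, c, d]"
    "cycle_of [c, b, a, d] = cycle_of [a, b, c, d]" "cycle_of [b, a, d, c] = cycle_of [a, b, c, d]"
    "cycle_of [a, d, c, b] = cycle_of [a, b, c, d]" for a b c d :: 'a
    by (simp_all only: cycle_of_4 insert_commute)
  ultimately show ?thesis
    using assms by (cases "(xs, ys)" rule: same_cycle.cases) fastforce+
qed

section \<open>Naming the vertices\<close>

lemma star_faces_map: "star_faces (g v) (map g rim) = map (map g) (star_faces v rim)"
  by (cases "(v, rim)" rule: star_faces.cases) simp_all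

lemma (in star_system) faces_at_image:
  assumes g: "inj_on g V" and v: "v \<in> V"
  shows "{C \<in> image (image g) ` \<Phi>. g v \<in> \<Union>C} = image (image g) ` {C \<in> \<Phi>. v \<in> \<Union>C}"
proof -
  have at: "g v \<in> \<Union>(image g ` C) \<longleftrightarrow> v \<in> \<Union>C" if "C \<in> \<Phi>" for C
  proof -
    have "\<Union>(image g ` C) = g ` \<Union>C" by blast
    moreover have "\<Union>C \<subseteq> V" using face_vertex[OF that] by simp
    ultimately show ?thesis using inj_on_image_mem_iff[OF g v] by metis
  qed
  have "{C \<in> image (image g) ` \<Phi>. g v \<in> \<Union>C} = image (image g) ` {C \<in> \<Phi>. g v \<in> \<Union>(image g ` C)}"
    by blast
  also have "{C \<in> \<Phi>. g v \<in> \<Union>(image g ` C)} = {C \<in> \<Phi>. v \<in> \<Union>C}"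
    using at by (intro Collect_cong conj_cong refl)
  finally show ?thesis .
qed

lemma (in star_system) is_star_image:
  assumes g: "inj_on g V" and v: "v \<in> V" and star: "is_star \<Phi> v rim" and rim: "set rim \<subseteq> V"
  shows "is_star (image (image g) ` \<Phi>) (g v) (map g rim)"
proof -
  have star': "length rim = 9" "distinct (v # rim)" "{C \<in> \<Phi>. v \<in> \<Union>C} = cycle_of ` set (star_faces v rim)"
    using star unfolding is_star_def by (simp_all only: simp_thms)
  have "distinct (map g (v # rim))"
    using star'(2) inj_on_subset[OF g, of "set (v # rim)"] v rim unfolding distinct_map by simp
  moreover have "{C \<in> image (image g) ` \<Phi>. g v \<in> \<Union>C} = cycle_of ` set (star_faces (g v) (map g rim))"
    unfolding faces_at_image[OF g v] star'(3) star_faces_map by (simp add: image_image image_cycle_of)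
  ultimately show ?thesis using star'(1) by (simp only: is_star_def length_map list.map simp_thms)
qed

lemma (in star_system) rim_subset:
  assumes "is_star \<Phi> v rim" shows "set rim \<subseteq> V"
proof -
  obtain w0 w1 x1 w2 x2 w3 x3 w4 x4 where rim: "rim = [w0, w1, x1, w2, x2, w3, x3, w4, x4]"
    and at: "{C \<in> \<Phi>. v \<in> \<Union>C} = {cycle_of [v, w0, w1], cycle_of [v, w1, x1, w2], cycle_of [v, w2, x2, w3],
       cycle_of [v, w3, x3, w4], cycle_of [v, w4, x4, w0]}"
    by (rule is_starE[OF assms])
  have sub: "set F \<subseteq> V" if "cycle_of F \<in> {C \<in> \<Phi>. v \<in> \<Union>C}" for F
    using face_vertex[of "cycle_of F"] that unfolding Union_cycle_of by simp
  have "set [v, w0, w1] \<subseteq> V" "set [v, w1, x1, w2] \<subseteq> V" "set [v, w2, x2, w3] \<subseteq> V"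
    "set [v, w3, x3, w4] \<subseteq> V" "set [v, w4, x4, w0] \<subseteq> V"
    by (rule sub; unfold at; simp)+
  then show ?thesis by (simp add: rim)
qed

lemma (in star_system) star_system_image:
  assumes g: "inj_on g V"
  shows "star_system (g ` V) (image (image g) ` \<Phi>)"
proof (rule star_system.intro)
  show "\<Union>C' \<subseteq> g ` V \<and> \<Union>C' \<noteq> {}" if C': "C' \<in> image (image g) ` \<Phi>" for C'
  proof -
    obtain C where C: "C \<in> \<Phi>" "C' = image g ` C" using C' by blast
    have "\<Union>C' = g ` \<Union>C" unfolding C(2) by blast
    then show ?thesis using face_vertex[OF C(1)] by (simp only: image_is_empty image_mono simp_thms)
  qed
  show "meet_properly (image (image g) ` \<Phi>)"
    unfolding meet_properly_def
  proof (intro ballI impI allI)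
    fix C' D' u' v'
    assume CD: "C' \<in> image (image g) ` \<Phi>" "D' \<in> image (image g) ` \<Phi>" and ne: "C' \<noteq> D'"
      and uv': "u' \<noteq> v' \<and> {u', v'} \<subseteq> \<Union>C' \<inter> \<Union>D'"
    obtain C where C: "C \<in> \<Phi>" "C' = image g ` C" using CD(1) by blast
    obtain D where D: "D \<in> \<Phi>" "D' = image g ` D" using CD(2) by blast
    have U: "\<Union>C' = g ` \<Union>C" "\<Union>D' = g ` \<Union>D" unfolding C(2) D(2) by blast+
    have sub: "\<Union>C \<subseteq> V" "\<Union>D \<subseteq> V" using face_vertex[OF C(1)] face_vertex[OF D(1)] by simp_all
    have "g ` \<Union>C \<inter> g ` \<Union>D = g ` (\<Union>C \<inter> \<Union>D)" by (rule inj_on_image_Int[OF g sub, symmetric])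
    then have "u' \<in> g ` (\<Union>C \<inter> \<Union>D)" "v' \<in> g ` (\<Union>C \<inter> \<Union>D)" using uv' unfolding U by auto
    then obtain u v where uv: "u \<in> \<Union>C \<inter> \<Union>D" "u' = g u" "v \<in> \<Union>C \<inter> \<Union>D" "v' = g v" by blast
    then have "u \<noteq> v \<and> {u, v} \<subseteq> \<Union>C \<inter> \<Union>D" using uv' by blast
    moreover have "C \<noteq> D" using ne C(2) D(2) by blast
    ultimately have "{u, v} \<in> C \<inter> D"
      using meet[unfolded meet_properly_def, rule_format, OF C(1) D(1)] by blast
    then have "g ` {u, v} \<in> C' \<inter> D'" unfolding C(2) D(2) by blast
    then show "{u', v'} \<in> C' \<inter> D'" using uv by simp
  qed
  show "\<exists>rim. is_star (image (image g) ` \<Phi>) v' rim" if v': "v' \<in> g ` V" for v'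
  proof -
    obtain v where v: "v \<in> V" "v' = g v" using v' by blast
    then obtain rim where "is_star \<Phi> v rim" using star by blast
    then show ?thesis using is_star_image[OF g v(1)] rim_subset v(2) by blast
  qed
qed

lemma ex_labelling:
  assumes "distinct ys" "distinct ls" "length ys = length ls"
  obtains g where "map g ys = ls" "inj_on g (set ys)" "g ` set ys = set ls"
proof -
  let ?g = "\<lambda>x. the (map_of (zip ys ls) x)"
  have "map ?g ys = ls"
    using assms by (intro nth_equalityI) (simp_all add: map_of_zip_nth)
  then show thesis using that[of ?g] assms(2) by (metis distinct_map set_map)
qed

section \<open>Classification up to isomorphism\<close>

text \<open>A vertex lies on five faces of the map, so five listed faces at each vertex leave no room for
  further ones.\<close>

lemma (in labelled_star_system) all_faces_listed:
  assumes s: "consistent \<Phi> s"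
    and five: "\<And>v. length (filter (\<lambda>F. v \<in> set F) (fst s)) = 5"
  shows "\<Phi> = cycle_of ` set (fst s)"
proof
  show "cycle_of ` set (fst s) \<subseteq> \<Phi>" by (rule known_faces_subset[OF s])
  have distinct: "distinct (map cycle_of (fst s))" using s unfolding consistent_def by simp
  show "\<Phi> \<subseteq> cycle_of ` set (fst s)"
  proof
    fix C assume C: "C \<in> \<Phi>"
    then obtain v where v: "v \<in> \<Union>C" using face_vertex[OF C] by blast
    let ?at = "filter (\<lambda>F. v \<in> set F) (fst s)"
    have "distinct (map cycle_of ?at)" using distinct by (rule distinct_map_filter)
    then have "card (cycle_of ` set ?at) = 5" using distinct_card[of "map cycle_of ?at"] five[of v] by simp
    moreover have "cycle_of ` set ?at \<subseteq> {C \<in> \<Phi>. v \<in> \<Union>C}"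
    proof
      fix D assume "D \<in> cycle_of ` set ?at"
      then obtain F where F: "D = cycle_of F" "F \<in> set (fst s)" "v \<in> set F" by auto
      have "D \<in> \<Phi>" using known_faces_subset[OF s] F(1,2) by blast
      moreover have "v \<in> \<Union>D" using F(3) unfolding F(1) Union_cycle_of .
      ultimately show "D \<in> {C \<in> \<Phi>. v \<in> \<Union>C}" by simp
    qed
    moreover have c5: "card {C \<in> \<Phi>. v \<in> \<Union>C} = 5" by (rule card_faces_at) simp
    moreover have "finite {C \<in> \<Phi>. v \<in> \<Union>C}" by (rule card_ge_0_finite) (unfold c5, simp)
    ultimately have "cycle_of ` set ?at = {C \<in> \<Phi>. v \<in> \<Union>C}" by (intro card_subset_eq) simp_all
    moreover have "C \<in> {C \<in> \<Phi>. v \<in> \<Union>C}" using C v by simp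
    ultimately show "C \<in> cycle_of ` set (fst s)" by auto
  qed
qed

fun number :: "label \<Rightarrow> nat" where
  "number L0 = 0" | "number L1 = 1" | "number L2 = 2" | "number L3 = 3" | "number L4 = 4" | "number L5 = 5"
| "number L6 = 6" | "number L7 = 7" | "number L8 = 8" | "number L9 = 9" | "number L10 = 10" | "number L11 = 11"

lemma bij_number: "bij_betw number UNIV {0..11}"
proof -
  have "inj number"
  proof (rule injI)
    fix x y assume "number x = number y" then show "x = y" by (cases x; cases y) simp_all
  qed
  moreover have "range number = {0..11}"
  proof -
    have "range number = number ` set labels" by (simp add: set_labels)
    also have "\<dots> = set (map number labels)" by simp
    also have "\<dots> = {0..11}" by (simp add: labels_def atLeastAtMost_insertL[symmetric] numeral_eq_Suc)
    finally show ?thesis .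
  qed
  ultimately show ?thesis by (simp add: bij_betw_def)
qed

lemma numbered_faces:
  "faces KNO1 = cycle_of ` map number ` set KNO1_faces"
  "faces KNO2 = cycle_of ` map number ` set KNO2_faces"
  "faces KO = cycle_of ` map number ` set KO_faces"
  by (simp_all add: KNO1_def KNO2_def KO_def KNO1_faces_def KNO2_faces_def KO_faces_def del: One_nat_def)

text \<open>The isomorphism is composed of the naming \<open>g\<close> of the vertices, the relabelling \<open>\<pi>\<close> supplied for
  the completion that the search has found, and the numbering of the labels.\<close>

lemma isomorphic_to_one_of_three:
  assumes K: "semi_equivelar K [(3, 1), (4, 4)]" and V: "card (verts K) = 12"
  obtains X where "X \<in> {KNO1, KNO2, KO}" "isomorphic_maps K X"
proof -
  interpret K: star_system "verts K" "faces K" by (rule semi_equivelar_star_system[OF K])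
  have fin: "finite (verts K)" using V card_ge_0_finite[of "verts K"] by simp
  obtain v where v: "v \<in> verts K" using V by fastforce
  obtain rim where rim: "is_star (faces K) v rim" using K.star[OF v] by blast
  have rim': "length rim = 9" "distinct (v # rim)" using rim unfolding is_star_def by simp_all
  have sub: "set (v # rim) \<subseteq> verts K" using K.rim_subset[OF rim] v by simp
  have "card (set (v # rim)) = 10" using distinct_card[OF rim'(2)] rim'(1) by simp
  then have "card (verts K - set (v # rim)) = 2" using V card_Diff_subset[OF _ sub] by simp
  then obtain p q where pq: "verts K - set (v # rim) = {p, q}" "p \<noteq> q" by (auto simp: card_2_iff)
  \<comment> \<open>the rim is named so that the star becomes the one from which the search starts\<close>
  let ?vs = "(v # rim) @ [p, q]" and ?ls = "(L0 # [L3, L4, L5, L6, L7, L8, L9, L1, L2]) @ [L10, L11]"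
  have "set [p, q] = verts K - set (v # rim)" using pq(1) by simp
  then have vs: "distinct ?vs" "set ?vs = verts K"
    unfolding distinct_append set_append using rim'(2) pq(2) sub by auto
  have "set ?ls = set labels" by (auto simp: labels_def)
  then have ls: "set ?ls = UNIV" by (simp only: set_labels)
  obtain g where g: "map g ?vs = ?ls" "inj_on g (set ?vs)" "g ` set ?vs = set ?ls"
    by (rule ex_labelling[OF vs(1), of ?ls]) (use rim'(1) in simp_all)
  have g_inj: "inj_on g (verts K)" and g_img: "g ` verts K = UNIV"
    using g(2,3) unfolding vs(2) ls by simp_all
  have g_star: "map g (v # rim) = L0 # [L3, L4, L5, L6, L7, L8, L9, L1, L2]"
    using g(1) rim'(1) unfolding map_append by (subst (asm) append_eq_append_conv) simp_all
  define \<Phi> where "\<Phi> = image (image g) ` faces K"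
  interpret labelled_star_system \<Phi>
    unfolding labelled_star_system_def \<Phi>_def using K.star_system_image[OF g_inj] unfolding g_img .
  have "is_star \<Phi> (g v) (map g rim)"
    unfolding \<Phi>_def by (rule K.is_star_image[OF g_inj v rim K.rim_subset[OF rim]])
  then have "is_star \<Phi> L0 [L3, L4, L5, L6, L7, L8, L9, L1, L2]" using g_star by simp
  then obtain s where s: "s \<in> set all_maps" "consistent \<Phi> s" using all_maps_complete by blast
  obtain Fs \<pi> where in_rel: "(Fs, \<pi>) \<in> set relabellings" and match: "matches (fst s) (Fs, \<pi>)"
    by (rule all_maps_matched[OF s(1)])
  have \<Phi>: "\<Phi> = cycle_of ` set (fst s)"
    by (rule all_faces_listed[OF s(2)]) (use match in \<open>simp add: list_all_iff set_labels\<close>)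
  let ?p = "\<lambda>x. get x \<pi>"
  have "distinct (map ?p labels)" using match by (simp add: entries_eq)
  then have "inj ?p" unfolding distinct_map set_labels by simp
  moreover have "finite (UNIV :: label set)" unfolding set_labels[symmetric] by simp
  ultimately have p: "bij ?p" using finite_UNIV_inj_surj[of ?p] by (simp add: bij_def)
  have faces_p: "image (image ?p) ` \<Phi> = cycle_of ` set Fs"
  proof -
    have "image (image ?p) ` \<Phi> = cycle_of ` map ?p ` set (fst s)"
      unfolding \<Phi> by (simp add: image_image image_cycle_of)
    also have "\<dots> = cycle_of ` set Fs"
    proof
      show "cycle_of ` map ?p ` set (fst s) \<subseteq> cycle_of ` set Fs"
        unfolding image_image
      proof (rule image_subsetI)
        fix F assume "F \<in> set (fst s)"
        then obtain G where "G \<in> set Fs" "same_cycle (map ?p F) G"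
          using match by (auto simp: list_all_iff list_ex_iff)
        then show "cycle_of (map ?p F) \<in> cycle_of ` set Fs" using cycle_of_eq_if_same_cycle by (metis imageI)
      qed
      show "cycle_of ` set Fs \<subseteq> cycle_of ` map ?p ` set (fst s)"
      proof (rule image_subsetI)
        fix G assume "G \<in> set Fs"
        then obtain F where F: "F \<in> set (fst s)" "same_cycle (map ?p F) G"
          using match by (auto simp: list_all_iff list_ex_iff)
        have "cycle_of G = cycle_of (map ?p F)" by (rule cycle_of_eq_if_same_cycle[OF F(2), symmetric])
        then show "cycle_of G \<in> cycle_of ` map ?p ` set (fst s)" using F(1) by blast
      qed
    qed
    finally show ?thesis .
  qed
  have "fst ` set relabellings \<subseteq> {KNO1_faces, KNO2_faces, KO_faces}"
    by (simp add: relabellings_def)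
  then have "Fs \<in> {KNO1_faces, KNO2_faces, KO_faces}" using imageI[OF in_rel, of fst] by auto
  then consider "Fs = KNO1_faces" | "Fs = KNO2_faces" | "Fs = KO_faces" by blast
  then have "\<exists>X \<in> {KNO1, KNO2, KO}. verts X = {0..11} \<and> faces X = cycle_of ` map number ` set Fs"
  proof cases
    case 1 show ?thesis unfolding 1 numbered_faces(1)[symmetric] by (simp add: KNO1_def)
  next
    case 2 show ?thesis unfolding 2 numbered_faces(2)[symmetric] by (simp add: KNO2_def)
  next
    case 3 show ?thesis unfolding 3 numbered_faces(3)[symmetric] by (simp add: KO_def)
  qed
  then obtain X where X: "X \<in> {KNO1, KNO2, KO}" "verts X = {0..11}" "faces X = cycle_of ` map number ` set Fs"
    by (elim bexE conjE)
  let ?h = "number \<circ> (?p \<circ> g)"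
  have "bij_betw g (verts K) UNIV" using g_inj g_img by (simp add: bij_betw_def)
  then have h: "bij_betw ?h (verts K) (verts X)"
    unfolding X(2) by (intro bij_betw_trans[OF _ bij_number] bij_betw_trans[OF _ p])
  have "(\<lambda>C. (\<lambda>e. ?h ` e) ` C) ` faces K = image (image number) ` image (image ?p) ` \<Phi>"
    unfolding \<Phi>_def by (simp add: image_image image_comp comp_def)
  also have "\<dots> = faces X" unfolding faces_p X(3) by (simp add: image_image image_cycle_of)
  finally have "isomorphic_maps K X" unfolding isomorphic_maps_def using h by blast
  then show thesis using that X(1) by blast
qed

section \<open>Orientability\<close>

text \<open>Along a directed cycle every vertex has one incoming and one outgoing arc. Hence if one side at \<open>v\<close>
  is directed towards \<open>v\<close>, the other one leads away from \<open>v\<close>.\<close>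

lemma arc_turn:
  assumes "distinct xs" "{a, v} \<in> cycle_of xs" "{v, b} \<in> cycle_of xs" "a \<noteq> b"
  shows "(a, v) \<in> arcs_of xs \<longleftrightarrow> (v, b) \<in> arcs_of xs"
  using assms arcs_of_left_unique[OF assms(1)] arcs_of_right_unique[OF assms(1)]
  unfolding in_cycle_of by metis

lemma arcs_of_antisym:
  assumes "distinct xs" "3 \<le> length xs" "(u, v) \<in> arcs_of xs"
  shows "(v, u) \<notin> arcs_of xs"
proof
  assume "(v, u) \<in> arcs_of xs"
  then obtain i j where ij: "i < length xs" "j < length xs" "u = xs ! i" "v = xs ! (Suc i mod length xs)"
    "v = xs ! j" "u = xs ! (Suc j mod length xs)"
    using assms(3) by (auto simp: arcs_of_nth)
  have "Suc i mod length xs < length xs" "Suc j mod length xs < length xs"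
    using assms(2) by (auto intro!: mod_less_divisor)
  then have "j = Suc i mod length xs" "i = Suc j mod length xs"
    using ij assms(1) by (metis nth_eq_iff_index_eq)+
  then show False using assms(2) ij by (auto simp: mod_Suc split: if_splits)
qed

text \<open>Going around the polygon, the direction of one side determines that of the next one, so a cycle
  has only two directions and these have no arc in common.\<close>

lemma arcs_of_subset_if_common_arc:
  assumes xs: "distinct xs" "3 \<le> length xs" and ys: "distinct ys" "3 \<le> length ys"
    and eq: "cycle_of xs = cycle_of ys"
    and uv: "(u, v) \<in> arcs_of xs" "(u, v) \<in> arcs_of ys"
  shows "arcs_of xs \<subseteq> arcs_of ys"
proof -
  let ?n = "length xs"
  let ?P = "\<lambda>i. (xs ! i, xs ! (Suc i mod ?n)) \<in> arcs_of ys"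
  have edge: "{xs ! i, xs ! (Suc i mod ?n)} \<in> cycle_of ys" if "i < ?n" for i
    using that unfolding eq[symmetric] in_cycle_of by (auto simp: arcs_of_nth)
  have step: "?P i \<longleftrightarrow> ?P (Suc i mod ?n)" if i: "i < ?n" for i
  proof (rule arc_turn[OF ys(1) edge[OF i] edge])
    show "Suc i mod ?n < ?n" using xs(2) by (auto intro!: mod_less_divisor)
    have "Suc (Suc i mod ?n) mod ?n < ?n" using xs(2) by (intro mod_less_divisor) linarith
    moreover have "i \<noteq> Suc (Suc i mod ?n) mod ?n"
    proof -
      consider "Suc i = ?n" | "Suc (Suc i) = ?n" | "Suc (Suc i) < ?n" using i by linarith
      then show ?thesis
      proof cases
        case 1
        then have "Suc (Suc i mod ?n) mod ?n = 1" using xs(2) by simp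
        then show ?thesis using 1 xs(2) by linarith
      next
        case 2
        then have "Suc (Suc i mod ?n) mod ?n = 0" using i by simp
        then show ?thesis using 2 xs(2) by linarith
      qed simp
    qed
    ultimately show "xs ! i \<noteq> xs ! (Suc (Suc i mod ?n) mod ?n)"
      using xs(1) i by (simp add: nth_eq_iff_index_eq)
  qed
  have all: "?P i \<longleftrightarrow> ?P 0" if "i < ?n" for i
    using that
  proof (induction i)
    case (Suc i)
    then show ?case using step[of i] by simp
  qed simp
  obtain i where i: "i < ?n" "u = xs ! i" "v = xs ! (Suc i mod ?n)"
    using uv(1) by (auto simp: arcs_of_nth)
  then have "?P i" using uv(2) by simp
  then have "?P 0" using all[OF i(1)] by simp
  show ?thesis
  proof
    fix e assume "e \<in> arcs_of xs"
    then obtain j where "j < ?n" "e = (xs ! j, xs ! (Suc j mod ?n))" unfolding arcs_of_nth by blast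
    then show "e \<in> arcs_of ys" using all[of j] \<open>?P 0\<close> by simp
  qed
qed

lemma coherent_face:
  assumes "coherent_orientation X dir" "C \<in> faces X"
  obtains xs where "distinct xs" "3 \<le> length xs" "C = cycle_of xs" "dir C = arcs_of xs"
proof -
  have "\<exists>xs. distinct xs \<and> 3 \<le> length xs \<and> C = cycle_of xs \<and> dir C = arcs_of xs"
    by (rule bspec[OF conjunct1[OF assms(1)[unfolded coherent_orientation_def]] assms(2)])
  then show thesis using that by (elim exE conjE)
qed

lemma coherent_cross:
  assumes "coherent_orientation X dir" "C \<in> faces X" "D \<in> faces X" "C \<noteq> D" "{u, v} \<in> C" "{u, v} \<in> D"
  shows "(u, v) \<in> dir C \<longleftrightarrow> (v, u) \<in> dir D"
  by (rule conjunct2[OF assms(1)[unfolded coherent_orientation_def], rule_format, OF assms(2-4)])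
    (rule IntI[OF assms(5,6)])

lemma coherent_along_face:
  assumes dir: "coherent_orientation X dir" and xs: "distinct xs" "3 \<le> length xs" "cycle_of xs \<in> faces X"
    and arcs: "(u, v) \<in> arcs_of xs" "(u', v') \<in> arcs_of xs"
  shows "(u, v) \<in> dir (cycle_of xs) \<longleftrightarrow> (u', v') \<in> dir (cycle_of xs)"
proof -
  obtain ys where ys: "distinct ys" "3 \<le> length ys" "cycle_of xs = cycle_of ys" "dir (cycle_of xs) = arcs_of ys"
    by (rule coherent_face[OF dir xs(3)])
  show ?thesis unfolding ys(4) using arcs_of_subset_if_common_arc[OF xs(1,2) ys(1-3)] arcs by blast
qed

lemma coherent_reverse:
  assumes dir: "coherent_orientation X dir" and C: "C \<in> faces X" "{u, v} \<in> C"
  shows "(v, u) \<in> dir C \<longleftrightarrow> (u, v) \<notin> dir C"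
proof -
  obtain ys where ys: "distinct ys" "3 \<le> length ys" "C = cycle_of ys" "dir C = arcs_of ys"
    by (rule coherent_face[OF dir C(1)])
  show ?thesis using C(2) arcs_of_antisym[OF ys(1,2)] unfolding ys(4) unfolding ys(3) in_cycle_of by blast
qed

text \<open>Three faces form a closed band. Listed as here, \<open>xs\<close> and \<open>ys\<close> traverse their common side in opposite
  directions, and so do \<open>ys\<close> and \<open>zs\<close>, but \<open>zs\<close> and \<open>xs\<close> traverse theirs in the same direction.
  So a coherent orientation carried around the band comes back reversed.\<close>

lemma moebius_band_not_orientable:
  assumes faces: "{cycle_of xs, cycle_of ys, cycle_of zs} \<subseteq> faces X"
    and sets: "set xs \<noteq> set ys" "set ys \<noteq> set zs" "set zs \<noteq> set xs"
    and polygons: "distinct xs" "3 \<le> length xs" "distinct ys" "3 \<le> length ys" "distinct zs" "3 \<le> length zs"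
    and xy: "(a, b) \<in> arcs_of xs" "(b, a) \<in> arcs_of ys"
    and yz: "(c, d) \<in> arcs_of ys" "(d, c) \<in> arcs_of zs"
    and zx: "(e, f) \<in> arcs_of zs" "(e, f) \<in> arcs_of xs"
  shows "\<not> orientable X"
proof
  assume "orientable X"
  then obtain dir where dir: "coherent_orientation X dir" unfolding orientable_def by blast
  note cross = coherent_cross[OF dir]
  have distinct: "cycle_of xs \<noteq> cycle_of ys" "cycle_of ys \<noteq> cycle_of zs" "cycle_of zs \<noteq> cycle_of xs"
    using sets Union_cycle_of by metis+
  have "(e, f) \<in> dir (cycle_of xs) \<longleftrightarrow> (a, b) \<in> dir (cycle_of xs)"
    by (rule coherent_along_face[OF dir polygons(1,2) _ zx(2) xy(1)]) (use faces in simp)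
  also have "\<dots> \<longleftrightarrow> (b, a) \<in> dir (cycle_of ys)"
    by (rule cross) (use faces distinct xy in \<open>simp_all add: in_cycle_of\<close>)
  also have "\<dots> \<longleftrightarrow> (c, d) \<in> dir (cycle_of ys)"
    by (rule coherent_along_face[OF dir polygons(3,4) _ xy(2) yz(1)]) (use faces in simp)
  also have "\<dots> \<longleftrightarrow> (d, c) \<in> dir (cycle_of zs)"
    by (rule cross) (use faces distinct yz in \<open>simp_all add: in_cycle_of\<close>)
  also have "\<dots> \<longleftrightarrow> (e, f) \<in> dir (cycle_of zs)"
    by (rule coherent_along_face[OF dir polygons(5,6) _ yz(2) zx(1)]) (use faces in simp)
  also have "\<dots> \<longleftrightarrow> (f, e) \<in> dir (cycle_of xs)"
    by (rule cross) (use faces distinct zx in \<open>simp_all add: in_cycle_of\<close>)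
  also have "\<dots> \<longleftrightarrow> (e, f) \<notin> dir (cycle_of xs)"
    by (rule coherent_reverse[OF dir]) (use faces zx in \<open>simp_all add: in_cycle_of\<close>)
  finally show False by simp
qed

text \<open>If no arc occurs twice in the directed faces, then two faces with a common side traverse it in
  opposite directions.\<close>

lemma orientableI:
  assumes faces: "faces X = cycle_of ` set L"
    and polygons: "\<And>xs. xs \<in> set L \<Longrightarrow> distinct xs \<and> 3 \<le> length xs"
    and arcs: "distinct (concat (map (\<lambda>xs. zip xs (rotate1 xs)) L))"
  shows "orientable X"
proof -
  define rep where "rep C = (SOME xs. xs \<in> set L \<and> cycle_of xs = C)" for C
  have rep: "rep C \<in> set L \<and> cycle_of (rep C) = C" if "C \<in> faces X" for C
  proof -
    have "\<exists>xs. xs \<in> set L \<and> cycle_of xs = C" using that unfolding faces by blast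
    then show ?thesis unfolding rep_def by (rule someI_ex)
  qed
  have disjoint: "arcs_of (rep C) \<inter> arcs_of (rep D) = {}" if "C \<in> faces X" "D \<in> faces X" "C \<noteq> D" for C D
  proof -
    have "zip (rep C) (rotate1 (rep C)) \<noteq> zip (rep D) (rotate1 (rep D))"
    proof
      assume "zip (rep C) (rotate1 (rep C)) = zip (rep D) (rotate1 (rep D))"
      then have "arcs_of (rep C) = arcs_of (rep D)" by (simp add: arcs_of_def)
      then have "cycle_of (rep C) = cycle_of (rep D)" by (simp add: cycle_of_def)
      then show False using rep that by simp
    qed
    moreover have "\<forall>as bs. as \<in> set (map (\<lambda>xs. zip xs (rotate1 xs)) L) \<and>
        bs \<in> set (map (\<lambda>xs. zip xs (rotate1 xs)) L) \<and> as \<noteq> bs \<longrightarrow> set as \<inter> set bs = {}"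
      using arcs unfolding distinct_concat_iff by (elim conjE)
    ultimately show ?thesis using rep[OF that(1)] rep[OF that(2)] unfolding arcs_of_def by simp
  qed
  have "coherent_orientation X (\<lambda>C. arcs_of (rep C))"
    unfolding coherent_orientation_def
  proof (intro conjI ballI impI allI)
    show "\<exists>xs. distinct xs \<and> 3 \<le> length xs \<and> C = cycle_of xs \<and> arcs_of (rep C) = arcs_of xs" if "C \<in> faces X" for C
      using rep[OF that] polygons by blast
    fix C D u v
    assume CD: "C \<in> faces X" "D \<in> faces X" "C \<noteq> D" and uv: "{u, v} \<in> C \<inter> D"
    have "{u, v} \<in> cycle_of (rep C)" "{u, v} \<in> cycle_of (rep D)" using uv rep CD by simp_all
    then show "(u, v) \<in> arcs_of (rep C) \<longleftrightarrow> (v, u) \<in> arcs_of (rep D)"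
      using disjoint[OF CD] arcs_of_antisym[of "rep C" u v] arcs_of_antisym[of "rep D" u v] rep[OF CD(1)] rep[OF CD(2)] polygons
      unfolding in_cycle_of by blast
  qed
  then show ?thesis unfolding orientable_def by blast
qed

lemma isomorphic_maps_sym:
  assumes iso: "isomorphic_maps X Y" and sub: "\<And>C. C \<in> faces X \<Longrightarrow> \<Union>C \<subseteq> verts X"
  shows "isomorphic_maps Y X"
proof -
  obtain f where f: "bij_betw f (verts X) (verts Y)" "(\<lambda>C. (\<lambda>e. f ` e) ` C) ` faces X = faces Y"
    using iso unfolding isomorphic_maps_def by (elim exE conjE)
  let ?h = "inv_into (verts X) f"
  have inv: "?h ` f ` e = e" if "e \<subseteq> verts X" for e
    using that f(1) by (auto simp: bij_betw_def inv_into_f_f subset_iff image_iff)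
  have "(\<lambda>e. ?h ` e) ` (\<lambda>e. f ` e) ` C = C" if "C \<in> faces X" for C
  proof -
    have "?h ` f ` e = e" if "e \<in> C" for e using inv[of e] sub[OF \<open>C \<in> faces X\<close>] that by blast
    then show ?thesis by (simp add: image_image)
  qed
  then have "(\<lambda>C. (\<lambda>e. ?h ` e) ` C) ` faces Y = faces X"
    unfolding f(2)[symmetric] image_image by (simp add: image_image)
  then show ?thesis unfolding isomorphic_maps_def using bij_betw_inv_into[OF f(1)] by blast
qed

text \<open>The directed boundary of each face is carried over by the vertex bijection.\<close>

lemma orientable_isomorphic:
  assumes iso: "isomorphic_maps X Y" and sub: "\<And>C. C \<in> faces X \<Longrightarrow> \<Union>C \<subseteq> verts X"
    and X: "orientable X"
  shows "orientable Y"
proof -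
  obtain f where f: "bij_betw f (verts X) (verts Y)" "(\<lambda>C. (\<lambda>e. f ` e) ` C) ` faces X = faces Y"
    using iso unfolding isomorphic_maps_def by (elim exE conjE)
  obtain dir where dir: "coherent_orientation X dir" using X unfolding orientable_def by blast
  have inj: "inj_on f (verts X)" using f(1) by (rule bij_betw_imp_inj_on)
  let ?F = "\<lambda>C. (\<lambda>e. f ` e) ` C"
  have injF: "inj_on ?F (faces X)"
  proof (rule inj_on_subset)
    show "inj_on ?F (Pow (Pow (verts X)))" by (intro inj_on_image_Pow inj)
    show "faces X \<subseteq> Pow (Pow (verts X))" using sub by blast
  qed
  define dir' where "dir' C' = map_prod f f ` dir (inv_into (faces X) ?F C')" for C'
  have dir': "dir' (?F C) = map_prod f f ` dir C" if "C \<in> faces X" for C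
    unfolding dir'_def using inv_into_f_f[OF injF that] by simp
  have in_verts: "set xs \<subseteq> verts X" if "cycle_of xs \<in> faces X" for xs
    using sub[OF that] unfolding Union_cycle_of .
  have dir_iff: "(f u, f v) \<in> dir' (?F C) \<longleftrightarrow> (u, v) \<in> dir C" if C: "C \<in> faces X" "u \<in> verts X" "v \<in> verts X" for C u v
  proof -
    obtain xs where xs: "C = cycle_of xs" "dir C = arcs_of xs"
      by (rule coherent_face[OF dir C(1)])
    have "set xs \<subseteq> verts X" by (rule in_verts) (use C(1) xs(1) in simp)
    then have "arcs_of xs \<subseteq> verts X \<times> verts X" using arcs_of_subset[of xs] by blast
    then show ?thesis
      unfolding dir'[OF C(1)] xs(2)
      using inj_on_image_mem_iff[OF map_prod_inj_on[OF inj inj], of "(u, v)" "arcs_of xs"] C(2,3) by simp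
  qed
  have "coherent_orientation Y dir'"
    unfolding coherent_orientation_def f(2)[symmetric]
  proof (intro conjI ballI impI allI)
    fix C' assume "C' \<in> ?F ` faces X"
    then obtain C where C: "C \<in> faces X" "C' = ?F C" by blast
    obtain xs where xs: "distinct xs" "3 \<le> length xs" "C = cycle_of xs" "dir C = arcs_of xs"
      by (rule coherent_face[OF dir C(1)])
    have "distinct (map f xs)"
      using xs(1) inj_on_subset[OF inj in_verts] C(1) xs(3) by (simp add: distinct_map)
    moreover have "C' = cycle_of (map f xs)" using C(2) xs(3) by (simp add: image_cycle_of)
    moreover have "dir' C' = arcs_of (map f xs)" using dir'[OF C(1)] C(2) xs(4) by (simp add: arcs_of_map)
    ultimately show "\<exists>xs. distinct xs \<and> 3 \<le> length xs \<and> C' = cycle_of xs \<and> dir' C' = arcs_of xs"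
      using xs(2) by (intro exI[of _ "map f xs"]) simp
  next
    fix C' D' u' v'
    assume "C' \<in> ?F ` faces X" "D' \<in> ?F ` faces X" and ne: "C' \<noteq> D'" and e': "{u', v'} \<in> C' \<inter> D'"
    then obtain C D where C: "C \<in> faces X" "C' = ?F C" and D: "D \<in> faces X" "D' = ?F D" by blast
    obtain e1 e2 where e: "e1 \<in> C" "{u', v'} = f ` e1" "e2 \<in> D" "{u', v'} = f ` e2"
      using e' C(2) D(2) by auto
    have sub12: "e1 \<subseteq> verts X" "e2 \<subseteq> verts X" using sub[OF C(1)] sub[OF D(1)] e(1,3) by (simp_all add: Sup_le_iff)
    have "e1 = e2" using inj_on_image_eq_iff[OF inj sub12] e(2,4) by simp
    obtain u v where uv: "u \<in> e1" "u' = f u" "v \<in> e1" "v' = f v" using e(2) by blast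
    have "f ` e1 = f ` {u, v}" using e(2) uv by auto
    then have "e1 = {u, v}" using inj_on_image_eq_iff[OF inj sub12(1), of "{u, v}"] uv sub12(1) by auto
    then have "{u, v} \<in> C" "{u, v} \<in> D" using e(1,3) \<open>e1 = e2\<close> by simp_all
    moreover have "C \<noteq> D" using ne C(2) D(2) by blast
    ultimately have "(u, v) \<in> dir C \<longleftrightarrow> (v, u) \<in> dir D"
      using coherent_cross[OF dir C(1) D(1)] by blast
    moreover have "u \<in> verts X" "v \<in> verts X" using uv sub12(1) by blast+
    ultimately show "(u', v') \<in> dir' C' \<longleftrightarrow> (v', u') \<in> dir' D'"
      unfolding C(2) D(2) uv(2,4) using dir_iff[OF C(1), of u v] dir_iff[OF D(1), of v u] by blast
  qed
  then show ?thesis unfolding orientable_def by blast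
qed

lemma KNO1_not_orientable: "\<not> orientable KNO1"
proof (rule moebius_band_not_orientable)
  show "{cycle_of [6, 1, 10, 5], cycle_of [1, 6, 11, 2], cycle_of [11, 10, 5, 2]} \<subseteq> faces KNO1"
    by (simp add: KNO1_def cycle_of_4_rev[of 11 10 5 2])
  show "(6, 1) \<in> arcs_of [6, 1, 10, 5 :: nat]" "(1, 6) \<in> arcs_of [1, 6, 11, 2 :: nat]"
    "(11, 2) \<in> arcs_of [1, 6, 11, 2 :: nat]" "(2, 11) \<in> arcs_of [11, 10, 5, 2 :: nat]"
    "(10, 5) \<in> arcs_of [11, 10, 5, 2 :: nat]" "(10, 5) \<in> arcs_of [6, 1, 10, 5 :: nat]"
    by (simp_all add: arcs_of_def)
qed (simp_all add: set_eq_subset)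

lemma KNO2_not_orientable: "\<not> orientable KNO2"
proof (rule moebius_band_not_orientable)
  show "{cycle_of [0, 1, 2, 3], cycle_of [8, 9, 1, 0], cycle_of [9, 8, 2, 3]} \<subseteq> faces KNO2"
    by (simp add: KNO2_def cycle_of_4_rev[of 8 9 1 0] cycle_of_4_rev[of 9 8 2 3] del: One_nat_def)
  show "(0, 1) \<in> arcs_of [0, 1, 2, 3 :: nat]" "(1, 0) \<in> arcs_of [8, 9, 1, 0 :: nat]"
    "(8, 9) \<in> arcs_of [8, 9, 1, 0 :: nat]" "(9, 8) \<in> arcs_of [9, 8, 2, 3 :: nat]"
    "(2, 3) \<in> arcs_of [9, 8, 2, 3 :: nat]" "(2, 3) \<in> arcs_of [0, 1, 2, 3 :: nat]"
    by (simp_all add: arcs_of_def)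
qed (simp_all add: set_eq_subset)

lemma KO_orientable: "orientable KO"
proof (rule orientableI)
  let ?L = "[[0, 3, 4], [2, 6, 11], [9, 5, 1], [10, 8, 7],
      [0, 1, 2, 3], [0, 4, 5, 6], [0, 6, 7, 8], [8, 9, 1, 0], [1, 7, 6, 2], [5, 10, 11, 6],
      [9, 11, 4, 3], [8, 2, 11, 9], [3, 2, 8, 10], [3, 10, 5, 9], [7, 1, 5, 4], [11, 10, 7, 4 :: nat]]"
  show "faces KO = cycle_of ` set ?L"
    by (simp add: KO_def cycle_of_3_rev[of 9 5 1] cycle_of_3_rev[of 10 8 7] cycle_of_4_rev[of 8 9 1 0]
        cycle_of_4_rev[of 5 10 11 6] cycle_of_4_rev[of 9 11 4 3] cycle_of_4_rev[of 8 2 11 9]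
        cycle_of_4_rev[of 7 1 5 4] cycle_of_4_rev[of 11 10 7 4] del: One_nat_def)
  show "distinct xs \<and> 3 \<le> length xs" if "xs \<in> set ?L" for xs
    using that by auto
  show "distinct (concat (map (\<lambda>xs. zip xs (rotate1 xs)) ?L))"
    by simp
qed

lemma KO_faces_subset: "C \<in> faces KO \<Longrightarrow> \<Union>C \<subseteq> verts KO"
  by (auto simp: KO_def cycle_of_3 cycle_of_4)

theorem theorem1p1:
  fixes K :: "'a complex2"
  assumes "semi_equivelar K [(3, 1), (4, 4)]"
    and "card (verts K) = 12"
    and "euler_char K = -2"
  shows "(\<not> orientable K \<longrightarrow> isomorphic_maps K KNO1 \<or> isomorphic_maps K KNO2) \<and>
         (orientable K \<longrightarrow> isomorphic_maps K KO)"
proof -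
  interpret star_system "verts K" "faces K" by (rule semi_equivelar_star_system[OF assms(1)])
  have sub: "\<Union>C \<subseteq> verts K" if "C \<in> faces K" for C using face_vertex[OF that] by simp
  obtain X where X: "X \<in> {KNO1, KNO2, KO}" and iso: "isomorphic_maps K X"
    by (rule isomorphic_to_one_of_three[OF assms(1,2)])
  have "orientable X" if "orientable K" by (rule orientable_isomorphic[OF iso sub that])
  moreover have "orientable K" if "X = KO"
  proof (rule orientable_isomorphic)
    show "isomorphic_maps X K" by (rule isomorphic_maps_sym[OF iso sub])
    show "orientable X" using that KO_orientable by simp
    show "\<Union>C \<subseteq> verts X" if "C \<in> faces X" for C
      using that KO_faces_subset \<open>X = KO\<close> by simp
  qed
  ultimately show ?thesis using X iso KNO1_not_orientable KNO2_not_orientable by auto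
qed

end
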